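(* Let $d\ge 1$, let $\Omega\subset\mathbb{R}^d$ be a Borel set of positive and finite measure, and let $A\subset\mathbb{R}^d$ be a countable set. Let $\phi\in PW_\Omega(\mathbb{R}^d)$ be such that $\hat\phi$ is continuous and nowhere zero on $\Omega$. If $\Omega$ is compact, then $\{\phi(\cdot-a)\}_{a\in A}$ is a Riesz basis for $PW_\Omega(\mathbb{R}^d)$ if and only if $\{e_a\}_{a\in A}$ is a Riesz basis for $L^2(\Omega)$.
   Context: The Fourier transform is $\hat\phi(\xi)=\int e^{-2\pi i x\cdot\xi}\phi(x)\,dx$. The Paley-Wiener space is $PW_\Omega(\mathbb{R}^d)=\{f\in L^2(\mathbb{R}^d):\hat f(\xi)=0\text{ for a.e. }\xi\in\Omega^c\}$. For $\phi\in PW_\Omega(\mathbb{R}^d)$, $\hat\phi$ is nowhere zero on $\Omega$ if $\hat\phi(\xi)\neq 0$ for all $\xi\in\Omega$. For $a\in A$, $e_a(x)=e^{-2\pi i\langle x,a\rangle}$ for $x\in\Omega$. The system $\{\phi(\cdot-a)\}_{a\in A}$ is called a Riesz basis for $PW_\Omega(\mathbb{R}^d)$ if there exist positive and finite numbers $C_1,C_2$ such that for any $f\in PW_\Omega(\mathbb{R}^d)$ there is $\{c_a\}_{a\in A}\in\ell^2(A)$ such that $f(x)=\sum_{a\in A}c_a\phi(x-a)$ and $C_1\sum_{a\in A}|c_a|^2\le\|f\|_2^2\le C_2\sum_{a\in A}|c_a|^2$. Likewise, $\{e_a\}_{a\in A}$ is called a Riesz basis for $L^2(\Omega)$ if there exist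 positive and finite constants $C_1,C_2$ such that for any $f\in L^2(\Omega)$ there is $\{c_a\}_{a\in A}\in\ell^2(A)$ such that $f=\sum_{a\in A}c_ae_a$ and $C_1\sum_{a\in A}|c_a|^2\le\|f\|_{L^2(\Omega)}^2\le C_2\sum_{a\in A}|c_a|^2$. *)

theory Defs
  imports "HOL-Analysis.Analysis"
begin

text \<open>
  Elements of \<open>L\<^sup>2\<close> are represented by Borel measurable functions rather than by classes modulo
  equality almost everywhere; every notion below that takes a function in \<open>L2 M\<close> depends only on
  its class.  \<open>L\<^sup>2(\<Omega>)\<close> is \<open>L2 (restrict_space lborel \<Omega>)\<close>.
\<close>

definition L2 :: "'a measure \<Rightarrow> ('a \<Rightarrow> complex) set" where
  "L2 M = {f \<in> borel_measurable M. integrable M (\<lambda>x. (cmod (f x))\<^sup>2)}"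

definition L2_normsq :: "'a measure \<Rightarrow> ('a \<Rightarrow> complex) \<Rightarrow> real" where
  "L2_normsq M f = (LINT x|M. (cmod (f x))\<^sup>2)"

text \<open>
  Convergence in \<open>L\<^sup>2\<close>.  The squared distance is taken in \<open>ennreal\<close>, so that a difference that is
  not square integrable has distance \<open>\<infinity>\<close> (the Bochner integral would return 0).
\<close>

definition L2_tendsto :: "'a measure \<Rightarrow> ('i \<Rightarrow> 'a \<Rightarrow> complex) \<Rightarrow> ('a \<Rightarrow> complex) \<Rightarrow> 'i filter \<Rightarrow> bool" where
  "L2_tendsto M u f F \<longleftrightarrow>
     ((\<lambda>i. \<integral>\<^sup>+ x. ennreal ((cmod (u i x - f x))\<^sup>2) \<partial>M) \<longlongrightarrow> 0) F"

text \<open>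
  The Fourier transform on \<open>L\<^sup>2\<close>, as a relation between representatives: \<open>g\<close> is the limit in
  \<open>L\<^sup>2\<close>, as \<open>R \<rightarrow> \<infinity>\<close>, of the integrals of \<open>exp (-2 \<pi> i x \<bullet> \<xi>) f x\<close> over the balls of radius \<open>R\<close>.
  The truncations of \<open>f\<close> are integrable and converge to \<open>f\<close> in \<open>L\<^sup>2\<close>, so this is the continuous
  extension of the integral from the intersection of \<open>L\<^sup>1\<close> and \<open>L\<^sup>2\<close>.
\<close>

definition has_L2_fourier :: "('a::euclidean_space \<Rightarrow> complex) \<Rightarrow> ('a \<Rightarrow> complex) \<Rightarrow> bool" where
  "has_L2_fourier f g \<longleftrightarrow> f \<in> L2 lborel \<and> g \<in> L2 lborel \<and>
     L2_tendsto lborel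
       (\<lambda>R \<xi>. LINT x:cball 0 R|lborel. cis (- 2 * pi * (x \<bullet> \<xi>)) * f x) g at_top"

definition PW :: "'a::euclidean_space set \<Rightarrow> ('a \<Rightarrow> complex) set" where
  "PW \<Omega> = {f \<in> L2 lborel. \<exists>g. has_L2_fourier f g \<and> (AE \<xi> in lborel. \<xi> \<notin> \<Omega> \<longrightarrow> g \<xi> = 0)}"

text \<open>
  The family \<open>u\<close>, indexed by \<open>A\<close>, is a Riesz basis for the space \<open>V\<close> of square integrable functions
  on \<open>M\<close>.  The expansions converge unconditionally in \<open>L\<^sup>2\<close>, as the index set carries no order.
  Uniqueness of the coefficients is deliberately not part of the definition.
\<close>

definition riesz_basis ::
    "'a measure \<Rightarrow> ('a \<Rightarrow> complex) set \<Rightarrow> 'i set \<Rightarrow> ('i \<Rightarrow> 'a \<Rightarrow> complex) \<Rightarrow> bool" where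
  "riesz_basis M V A u \<longleftrightarrow>
     (\<exists>C1 C2 :: real. C1 > 0 \<and> C2 > 0 \<and>
       (\<forall>f\<in>V. \<exists>c :: 'i \<Rightarrow> complex.
          (\<lambda>a. (cmod (c a))\<^sup>2) summable_on A \<and>
          L2_tendsto M (\<lambda>F x. \<Sum>a\<in>F. c a * u a x) f (finite_subsets_at_top A) \<and>
          C1 * (\<Sum>\<^sub>\<infinity>a\<in>A. (cmod (c a))\<^sup>2) \<le> L2_normsq M f \<and>
          L2_normsq M f \<le> C2 * (\<Sum>\<^sub>\<infinity>a\<in>A. (cmod (c a))\<^sup>2)))"

end

theory Submission
  imports Defs "HOL-Probability.Characteristic_Functions"
begin

text \<open>Compactness of \<Omega> enters twice. It gives the two bounds on
  \<open>\<phi>hat\<close>, and it makes \<Omega> bounded, so that a square integrable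
  \<open>G\<close> vanishing off \<Omega> is integrable and its inverse transform is an honest
  integral; surjectivity onto the functions on \<Omega> rests on this. Plancherel for bounded
  support suffices throughout because the truncations in \<open>has_L2_fourier\<close> have bounded
  support as well. Two obstacles shape the rest. The definition truncates at balls around the
  origin, while translating a function displaces the ball, so the limit has to be shown independent
  of the centre. And transforms are determined only up to null sets, so the correspondence between
  the two spaces is a relation \<open>T f h\<close> instead of a map. This relation passes to the
  difference of a finite partial sum and its target; the norm bounds for \<open>T\<close> then
  compare the approximation errors on the two sides with one constant \<open>K\<close>, which
  transports unconditional convergence.\<close>

text \<open>
  The Fourier transform maps the Paley-Wiener space isometrically onto the square integrable
  functions vanishing off \<open>\<Omega>\<close>, and it turns \<open>\<Sum> c\<^sub>a \<phi>(\<cdot> - a)\<close> into \<open>\<phi>hat \<cdot> \<Sum> c\<^sub>a e\<^sub>a\<close>.  On the compact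
  set \<open>\<Omega>\<close> the modulus of the continuous zero-free function \<open>\<phi>hat\<close> lies between two positive constants,
  so multiplication by \<open>\<phi>hat\<close> is an isomorphism of \<open>L\<^sup>2(\<Omega>)\<close> that changes norms by bounded factors only,
  and expansions with the same coefficients converge on both sides.

  Plancherel's theorem is proved for functions of bounded support: testing \<open>\<bar>f hat\<bar>\<^sup>2\<close> against a
  Gaussian of scale \<open>d\<close> and letting \<open>d \<rightarrow> 0\<close> gives \<open>\<parallel>f hat\<parallel> \<le> \<parallel>f\<parallel>\<close> for every integrable \<open>f\<close>, with
  equality for bounded continuous \<open>f\<close>; density does the rest.
\<close>

subsection \<open>Gaussians\<close>

lemma cis_measurable [measurable]: "cis \<in> borel_measurable borel"
  by (intro borel_measurable_continuous_onI continuous_intros)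

section \<open>Affine substitution in Lebesgue integrals\<close>

lemma nn_integral_lborel_affine:
  fixes f :: "'a::euclidean_space \<Rightarrow> ennreal"
  assumes [measurable]: "f \<in> borel_measurable borel" and c: "c \<noteq> 0"
  shows "(\<integral>\<^sup>+x. f x \<partial>lborel) = ennreal (\<bar>c\<bar> ^ DIM('a)) * (\<integral>\<^sup>+x. f (t + c *\<^sub>R x) \<partial>lborel)"
  by (subst lborel_affine[OF c, of t])
    (simp add: nn_integral_density nn_integral_distr nn_integral_cmult)

lemma integral_lborel_affine:
  fixes f :: "'a::euclidean_space \<Rightarrow> 'b::{banach, second_countable_topology}"
  assumes [measurable]: "f \<in> borel_measurable borel" and c: "c \<noteq> 0"
  shows "(\<integral>x. f x \<partial>lborel) = \<bar>c\<bar> ^ DIM('a) *\<^sub>R (\<integral>x. f (t + c *\<^sub>R x) \<partial>lborel)"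
  by (subst lborel_affine[OF c, of t])
    (simp add: integral_density integral_distr)

lemma integrable_lborel_affine:
  fixes f :: "'a::euclidean_space \<Rightarrow> 'b::{banach, second_countable_topology}"
  assumes f: "integrable lborel f" and c: "c \<noteq> 0"
  shows "integrable lborel (\<lambda>x. f (t + c *\<^sub>R x))"
proof -
  have [measurable]: "f \<in> borel_measurable borel" using f by auto
  have "(\<integral>\<^sup>+x. norm (f x) \<partial>lborel) < \<infinity>"
    using f by (simp add: integrable_iff_bounded)
  then have "ennreal (\<bar>c\<bar> ^ DIM('a)) * (\<integral>\<^sup>+x. norm (f (t + c *\<^sub>R x)) \<partial>lborel) < \<infinity>"
    by (subst (asm) nn_integral_lborel_affine[OF _ c, of _ t]) auto
  then show ?thesis
    using c by (auto simp: integrable_iff_bounded ennreal_mult_less_top)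
qed

text \<open>The substitution \<open>x = sqrt (2 * pi) * s\<close> turns the weight into the standard
  normal density, and the integral into its characteristic function at
  \<open>- sqrt (2 * pi) * z\<close>.\<close>

lemma gaussian_fourier_real:
  fixes z :: real
  shows "integrable lborel (\<lambda>s::real. complex_of_real (exp (- pi * s\<^sup>2)) * cis (- 2 * pi * (s * z)))"
    and "(LINT s|lborel. complex_of_real (exp (- pi * s\<^sup>2)) * cis (- 2 * pi * (s * z)))
           = complex_of_real (exp (- pi * z\<^sup>2))"
proof -
  let ?c = "sqrt (2 * pi)"
  let ?t = "- ?c * z"
  let ?h = "\<lambda>x::real. std_normal_density x *\<^sub>R cis (?t * x)"
  have c: "?c \<noteq> 0" "?c > 0" "?c * ?c = 2 * pi" by auto
  have h: "integrable lborel ?h"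
    by (rule Bochner_Integration.integrable_bound[of _ "std_normal_density"])
       (auto intro!: integrable_normal_density)
  have *: "complex_of_real (exp (- pi * s\<^sup>2)) * cis (- 2 * pi * (s * z)) = ?c *\<^sub>R ?h (?c * s)" for s :: real
  proof -
    have e1: "- (?c * s)\<^sup>2 / 2 = - pi * s\<^sup>2" by (simp add: power_mult_distrib)
    have e2: "?t * (?c * s) = - 2 * pi * (s * z)"
    proof -
      have "?t * (?c * s) = - (?c * ?c) * (s * z)" by (simp only: minus_mult_left mult_ac)
      then show ?thesis unfolding c(3) by simp
    qed
    show ?thesis
      unfolding std_normal_density_def e1 e2 by (simp add: scaleR_conv_of_real)
  qed
  show "integrable lborel (\<lambda>s::real. complex_of_real (exp (- pi * s\<^sup>2)) * cis (- 2 * pi * (s * z)))"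
    unfolding * using lborel_integrable_real_affine[OF h c(1), of 0]
    by (intro integrable_scaleR_right impI) (simp only: add_0)
  have "(LINT x|lborel. ?h x) = complex_of_real (exp (- pi * z\<^sup>2))"
  proof -
    have "(LINT x|lborel. ?h x) = char std_normal_distribution ?t"
      unfolding char_def by (subst integral_density) (auto simp: cis_conv_exp)
    also have "\<dots> = complex_of_real (exp (- (?t)\<^sup>2 / 2))"
      by (simp add: char_std_normal_distribution)
    also have "- (?t)\<^sup>2 / 2 = - pi * z\<^sup>2" by (simp add: power_mult_distrib)
    finally show ?thesis .
  qed
  moreover have "(LINT x|lborel. ?h x) = ?c *\<^sub>R (LINT s|lborel. ?h (?c * s))"
    using lborel_integral_real_affine[OF c(1), of ?h 0] by simp
  ultimately show "(LINT s|lborel. complex_of_real (exp (- pi * s\<^sup>2)) * cis (- 2 * pi * (s * z)))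
           = complex_of_real (exp (- pi * z\<^sup>2))"
    unfolding * by (simp only: integral_scaleR_right)
qed

text \<open>The factor \<open>pi\<close> is the normalisation for which the Gaussian has integral 1
  and is its own Fourier transform.\<close>

definition gaussian :: "'a::euclidean_space \<Rightarrow> real" where
  "gaussian x = exp (- pi * (x \<bullet> x))"

lemma gaussian_measurable [measurable]: "gaussian \<in> borel_measurable borel"
  unfolding gaussian_def by measurable

lemma gaussian_pos [simp]: "0 < gaussian x" and gaussian_nonneg [simp]: "0 \<le> gaussian x"
  by (auto simp: gaussian_def)

lemma gaussian_le_1 [simp]: "gaussian x \<le> 1"
  by (simp add: gaussian_def)

lemma cis_sum: "finite I \<Longrightarrow> cis (\<Sum>i\<in>I. f i) = (\<Prod>i\<in>I. cis (f i))"
  by (induction I rule: finite_induct) (auto simp flip: cis_mult)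

text \<open>Gaussian and character both factor over the coordinates, so Fubini on the product of
  real lines reduces the claim to dimension one.\<close>

lemma gaussian_fourier:
  fixes z :: "'a::euclidean_space"
  shows "integrable lborel (\<lambda>x::'a. complex_of_real (gaussian x) * cis (- 2 * pi * (x \<bullet> z)))"
    and "(LINT x|lborel. complex_of_real (gaussian x) * cis (- 2 * pi * (x \<bullet> z))) = gaussian z"
proof -
  interpret product_sigma_finite "\<lambda>_::'a. lborel :: real measure" ..
  let ?f = "\<lambda>b s. complex_of_real (exp (- pi * s\<^sup>2)) * cis (- 2 * pi * (s * (z \<bullet> b)))"
  have *: "complex_of_real (gaussian x) * cis (- 2 * pi * (x \<bullet> z)) = (\<Prod>b\<in>Basis. ?f b (x \<bullet> b))" for x :: 'a
  proof -
    have "gaussian x = (\<Prod>b\<in>Basis. exp (- pi * (x \<bullet> b)\<^sup>2))"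
      unfolding gaussian_def
      by (subst euclidean_inner[of x x]) (simp add: sum_distrib_left power2_eq_square exp_sum flip: sum_negf)
    moreover have "cis (- 2 * pi * (x \<bullet> z)) = (\<Prod>b\<in>Basis. cis (- 2 * pi * ((x \<bullet> b) * (z \<bullet> b))))"
      by (subst euclidean_inner[of x z]) (simp add: sum_distrib_left cis_sum flip: sum_negf)
    ultimately show ?thesis by (simp add: prod.distrib)
  qed
  have **: "(\<Sum>b\<in>Basis. y b *\<^sub>R b) \<bullet> i = y i" if "i \<in> Basis" for y and i :: 'a
    using that by simp
  have ***: "(\<Prod>i\<in>Basis. ?f i ((\<Sum>b\<in>Basis. y b *\<^sub>R b) \<bullet> i)) = (\<Prod>i\<in>(Basis :: 'a set). ?f i (y i))" for y
    by (intro prod.cong refl) (simp only: **)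
  have [measurable]: "(\<lambda>x::'a. \<Prod>b\<in>Basis. ?f b (x \<bullet> b)) \<in> borel_measurable borel"
    by measurable
  \<comment> \<open>Presents Lebesgue measure on \<open>'a\<close> as the image of a product
    measure; the folding keeps the factors on the real line written as
    \<open>lborel\<close>.\<close>
  note lborel_prod = lborel_def[where 'a='a, folded lborel_eq_real]
  have [measurable]: "(\<lambda>f. \<Sum>b\<in>Basis. f b *\<^sub>R b) \<in> (Pi\<^sub>M Basis (\<lambda>b::'a. lborel :: real measure)) \<rightarrow>\<^sub>M borel"
    by measurable
  show "integrable lborel (\<lambda>x::'a. complex_of_real (gaussian x) * cis (- 2 * pi * (x \<bullet> z)))"
    unfolding * lborel_prod
    by (subst integrable_distr_eq, measurable, subst ***)
       (intro product_integrable_prod gaussian_fourier_real finite_Basis)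
  have "(LINT x|lborel. (\<Prod>b\<in>Basis. ?f b (x \<bullet> b))) = (\<Prod>b\<in>Basis. exp (- pi * (z \<bullet> b)\<^sup>2))"
    unfolding lborel_prod
    by (subst integral_distr, measurable, subst ***, subst product_integral_prod[of _ ?f])
       (simp_all only: gaussian_fourier_real finite_Basis of_real_prod)
  also have "\<dots> = complex_of_real (gaussian z)"
    unfolding gaussian_def
    by (subst euclidean_inner[of z z]) (simp add: sum_distrib_left power2_eq_square exp_sum flip: sum_negf)
  finally show "(LINT x|lborel. complex_of_real (gaussian x) * cis (- 2 * pi * (x \<bullet> z))) = gaussian z"
    unfolding * .
qed

lemma gaussian_integrable: "integrable lborel (gaussian :: 'a::euclidean_space \<Rightarrow> real)"
  and gaussian_integral: "(LINT x|lborel. gaussian (x::'a)) = 1"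
  and gaussian_nn_integral: "(\<integral>\<^sup>+x. ennreal (gaussian (x::'a)) \<partial>lborel) = 1"
proof -
  show int: "integrable lborel (gaussian :: 'a \<Rightarrow> real)"
    using gaussian_fourier(1)[of 0] by (simp add: complex_of_real_integrable_eq)
  show "(LINT x|lborel. gaussian (x::'a)) = 1"
    using gaussian_fourier(2)[of "0 :: 'a"] by (simp add: gaussian_def)
  with int show "(\<integral>\<^sup>+x. ennreal (gaussian (x::'a)) \<partial>lborel) = 1"
    by (simp add: nn_integral_eq_integral)
qed

text \<open>As \<open>d\<close> tends to 0 the weight tends to 1 while its transform becomes an
  approximate identity. This duality drives the proof of Plancherel's theorem.\<close>

lemma gaussian_fourier_scaled:
  fixes z :: "'a::euclidean_space"
  assumes d: "d > 0"
  shows "integrable lborel (\<lambda>x::'a. complex_of_real (gaussian (d *\<^sub>R x)) * cis (- 2 * pi * (x \<bullet> z)))"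
    and "(LINT x|lborel. complex_of_real (gaussian (d *\<^sub>R x)) * cis (- 2 * pi * (x \<bullet> z)))
       = complex_of_real (gaussian (z /\<^sub>R d) / d ^ DIM('a))"
proof -
  let ?h = "\<lambda>x::'a. complex_of_real (gaussian x) * cis (- 2 * pi * (x \<bullet> (z /\<^sub>R d)))"
  have *: "complex_of_real (gaussian (d *\<^sub>R x)) * cis (- 2 * pi * (x \<bullet> z)) = ?h (0 + d *\<^sub>R x)" for x
    using d by (simp add: mult.assoc[symmetric])
  show "integrable lborel (\<lambda>x::'a. complex_of_real (gaussian (d *\<^sub>R x)) * cis (- 2 * pi * (x \<bullet> z)))"
    unfolding * using d by (intro integrable_lborel_affine gaussian_fourier) auto
  have "complex_of_real (gaussian (z /\<^sub>R d)) = d ^ DIM('a) *\<^sub>R (LINT x|lborel. ?h (0 + d *\<^sub>R x))"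
    using d by (subst gaussian_fourier(2)[symmetric], subst integral_lborel_affine[of _ d 0]) auto
  then show "(LINT x|lborel. complex_of_real (gaussian (d *\<^sub>R x)) * cis (- 2 * pi * (x \<bullet> z)))
       = complex_of_real (gaussian (z /\<^sub>R d) / d ^ DIM('a))"
    unfolding * using d by (simp add: scaleR_conv_of_real field_simps)
qed

subsection \<open>Square integrable functions\<close>

lemma cnj_measurable [measurable]: "cnj \<in> borel_measurable borel"
  by (intro borel_measurable_continuous_onI continuous_intros)

text \<open>The values are in \<open>ennreal\<close> so that norms can be compared before square
  integrability is known; \<open>L2_tendsto\<close> is convergence of this quantity for
  differences.\<close>

definition L2nn :: "'a measure \<Rightarrow> ('a \<Rightarrow> complex) \<Rightarrow> ennreal" where
  "L2nn M f = (\<integral>\<^sup>+x. ennreal ((cmod (f x))\<^sup>2) \<partial>M)"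

lemma L2_tendsto_L2nn: "L2_tendsto M u f F \<longleftrightarrow> ((\<lambda>i. L2nn M (\<lambda>x. u i x - f x)) \<longlongrightarrow> 0) F"
  by (simp add: L2_tendsto_def L2nn_def)

lemma L2D:
  assumes "f \<in> L2 M"
  shows "f \<in> borel_measurable M" "integrable M (\<lambda>x. (cmod (f x))\<^sup>2)" "L2nn M f < \<infinity>"
    "L2nn M f = ennreal (L2_normsq M f)"
proof -
  show m: "f \<in> borel_measurable M" "integrable M (\<lambda>x. (cmod (f x))\<^sup>2)"
    using assms by (auto simp: L2_def)
  then show e: "L2nn M f = ennreal (L2_normsq M f)"
    unfolding L2nn_def L2_normsq_def by (intro nn_integral_eq_integral) auto
  then show "L2nn M f < \<infinity>" by simp
qed

lemma L2I: "f \<in> borel_measurable M \<Longrightarrow> L2nn M f < \<infinity> \<Longrightarrow> f \<in> L2 M"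
  unfolding L2_def L2nn_def by (auto simp: integrable_iff_bounded)

lemma L2_iff: "f \<in> L2 M \<longleftrightarrow> f \<in> borel_measurable M \<and> L2nn M f < \<infinity>"
  using L2I L2D by blast

text \<open>Young's inequality for the cross term. A free weight \<open>s\<close> allows a factor
  close to 1 at \<open>a\<close>, which is what a limit of norms needs.\<close>

lemma norm_add_sq_le:
  fixes a b :: complex
  assumes "s > 0"
  shows "(cmod (a + b))\<^sup>2 \<le> (1 + s) * (cmod a)\<^sup>2 + (1 + 1 / s) * (cmod b)\<^sup>2"
proof -
  have "(cmod (a + b))\<^sup>2 \<le> (cmod a + cmod b)\<^sup>2"
    by (intro power_mono norm_triangle_ineq) auto
  also have "\<dots> = (1 + s) * (cmod a)\<^sup>2 + (1 + 1 / s) * (cmod b)\<^sup>2 - (s * cmod a - cmod b)\<^sup>2 / s"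
    using assms by (simp add: field_simps power2_eq_square)
  also have "\<dots> \<le> (1 + s) * (cmod a)\<^sup>2 + (1 + 1 / s) * (cmod b)\<^sup>2"
    using assms by simp
  finally show ?thesis .
qed

lemma L2nn_add_le:
  assumes [measurable]: "f \<in> borel_measurable M" "g \<in> borel_measurable M" and s: "s > 0"
  shows "L2nn M (\<lambda>x. f x + g x) \<le> ennreal (1 + s) * L2nn M f + ennreal (1 + 1 / s) * L2nn M g"
proof -
  have "L2nn M (\<lambda>x. f x + g x) \<le> (\<integral>\<^sup>+x. ennreal (1 + s) * ennreal ((cmod (f x))\<^sup>2)
      + ennreal (1 + 1 / s) * ennreal ((cmod (g x))\<^sup>2) \<partial>M)"
    unfolding L2nn_def using s norm_add_sq_le[OF s]
    by (intro nn_integral_mono) (simp flip: ennreal_mult ennreal_plus)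
  also have "\<dots> = ennreal (1 + s) * L2nn M f + ennreal (1 + 1 / s) * L2nn M g"
    unfolding L2nn_def by (simp add: nn_integral_add nn_integral_cmult)
  finally show ?thesis .
qed

lemma L2nn_cmult:
  assumes [measurable]: "f \<in> borel_measurable M"
  shows "L2nn M (\<lambda>x. c * f x) = ennreal ((cmod c)\<^sup>2) * L2nn M f"
  unfolding L2nn_def by (simp add: norm_mult power_mult_distrib ennreal_mult nn_integral_cmult)

lemma L2nn_minus_commute: "L2nn M (\<lambda>x. f x - g x) = L2nn M (\<lambda>x. g x - f x)"
  by (simp add: L2nn_def norm_minus_commute)

lemma L2_zero [simp]: "(\<lambda>x. 0) \<in> L2 M"
  by (simp add: L2_def)

lemma L2_add:
  assumes "f \<in> L2 M" "g \<in> L2 M"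
  shows "(\<lambda>x. f x + g x) \<in> L2 M"
proof -
  note [measurable] = L2D(1)[OF assms(1)] L2D(1)[OF assms(2)]
  have "L2nn M (\<lambda>x. f x + g x) \<le> ennreal (1 + 1) * L2nn M f + ennreal (1 + 1 / 1) * L2nn M g"
    by (intro L2nn_add_le) auto
  also have "\<dots> < \<infinity>"
    using L2D(3)[OF assms(1)] L2D(3)[OF assms(2)] by (simp add: ennreal_mult_less_top del: ennreal_plus)
  finally show ?thesis by (intro L2I) auto
qed

lemma L2_cmult: "f \<in> L2 M \<Longrightarrow> (\<lambda>x. c * f x) \<in> L2 M"
  using L2D[of f M] by (intro L2I) (auto simp: L2nn_cmult ennreal_mult_less_top)

lemma L2_diff:
  assumes "f \<in> L2 M" "g \<in> L2 M"
  shows "(\<lambda>x. f x - g x) \<in> L2 M"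
  using L2_add[OF assms(1) L2_cmult[OF assms(2), of "-1"]] by simp

text \<open>Young's inequality with a weight tied to the error \<open>e\<close>: for
  \<open>s = sqrt e\<close> the factor \<open>1 + s\<close> tends to 1 and
  \<open>(1 + 1/s) * e = s^2 + s\<close> tends to 0, which squeezes the norms.\<close>

lemma L2nn_tendsto:
  assumes meas: "\<And>i. u i \<in> borel_measurable M" and f: "f \<in> L2 M"
    and lim: "((\<lambda>i. L2nn M (\<lambda>x. u i x - f x)) \<longlongrightarrow> 0) F"
  shows "((\<lambda>i. L2nn M (u i)) \<longlongrightarrow> L2nn M f) F"
proof -
  note [measurable] = meas L2D(1)[OF f]
  define e where "e i = L2nn M (\<lambda>x. u i x - f x)" for i
  define s where "s i = sqrt (enn2real (e i))" for i
  define a where "a = L2_normsq M f"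
  have a: "L2nn M f = ennreal a" "a \<ge> 0"
    using L2D(4)[OF f] by (auto simp: a_def L2_normsq_def)
  define v where "v i = enn2real (L2nn M (u i))" for i
  have e_lim: "(e \<longlongrightarrow> 0) F" using lim by (simp add: e_def[abs_def])
  then have fin: "\<forall>\<^sub>F i in F. e i < 1" by (rule order_tendstoD) auto
  have "((\<lambda>i. enn2real (e i)) \<longlongrightarrow> 0) F"
    using tendsto_enn2real[of "\<lambda>i. e i" 0 F] e_lim by simp
  then have s_lim: "(s \<longlongrightarrow> 0) F"
    unfolding s_def[abs_def] using tendsto_real_sqrt by fastforce
  \<comment> \<open>Stated for arbitrary \<open>g\<close> and \<open>h\<close> because it is used in
    both directions, for an upper and for a lower bound on the norm of \<open>u i\<close>.\<close>
  have cmp: "L2nn M g \<le> ennreal (1 + s i) * L2nn M h + ennreal ((s i)\<^sup>2 + s i)"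
    if "e i < 1" and eq: "L2nn M (\<lambda>x. g x - h x) = e i"
      and [measurable]: "g \<in> borel_measurable M" "h \<in> borel_measurable M" for g h i
  \<comment> \<open>Young's inequality needs a positive weight; if the error vanishes,
    \<open>g\<close> and \<open>h\<close> agree almost everywhere instead.\<close>
  proof (cases "e i = 0")
    case True
    have "AE x in M. ennreal ((cmod (g x - h x))\<^sup>2) = 0"
      using eq True unfolding L2nn_def by (subst nn_integral_0_iff_AE[symmetric]) auto
    then have "L2nn M g = L2nn M h"
      unfolding L2nn_def by (intro nn_integral_cong_AE) auto
    with True show ?thesis by (simp add: s_def)
  next
    case False
    have "e i < \<infinity>" using \<open>e i < 1\<close> by (rule order.strict_trans) simp
    with False have ei: "e i = ennreal ((s i)\<^sup>2)" "s i > 0"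
      by (auto simp: s_def enn2real_positive_iff zero_less_iff_neq_zero)
    have "L2nn M g = L2nn M (\<lambda>x. h x + (g x - h x))" by simp
    also have "\<dots> \<le> ennreal (1 + s i) * L2nn M h + ennreal (1 + 1 / s i) * e i"
      using ei(2) by (subst eq[symmetric], intro L2nn_add_le) auto
    also have "ennreal (1 + 1 / s i) * e i = ennreal ((s i)\<^sup>2 + s i)"
      using ei(2) unfolding ei(1)
      by (subst ennreal_mult[symmetric])
        (auto simp: field_simps power2_eq_square simp del: ennreal_plus intro!: arg_cong[of _ _ ennreal])
    finally show ?thesis .
  qed
  have s0: "s i \<ge> 0" for i by (simp add: s_def)
  have comb: "ennreal (1 + s i) * ennreal x + ennreal ((s i)\<^sup>2 + s i)
      = ennreal ((1 + s i) * x + ((s i)\<^sup>2 + s i))" if "x \<ge> 0" for i x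
    using that s0[of i] by (subst ennreal_mult[symmetric], simp, simp, subst ennreal_plus[symmetric]) auto
  have both: "\<forall>\<^sub>F i in F. L2nn M (u i) = ennreal (v i) \<and> v i \<le> (1 + s i) * a + ((s i)\<^sup>2 + s i)
      \<and> (a - ((s i)\<^sup>2 + s i)) / (1 + s i) \<le> v i"
    using fin
  proof eventually_elim
    case (elim i)
    have 1: "L2nn M (u i) \<le> ennreal ((1 + s i) * a + ((s i)\<^sup>2 + s i))"
      using cmp[OF elim, of "u i" f] a by (simp add: e_def comb del: ennreal_plus)
    then have "L2nn M (u i) < top" by (rule le_less_trans) simp
    then have 2: "L2nn M (u i) = ennreal (v i)" "v i \<ge> 0"
      by (auto simp: v_def)
    have "ennreal a \<le> ennreal ((1 + s i) * v i + ((s i)\<^sup>2 + s i))"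
      using cmp[OF elim, of f "u i"] a 2
      by (simp add: e_def L2nn_minus_commute[of M f] comb del: ennreal_plus)
    then have "a \<le> (1 + s i) * v i + ((s i)\<^sup>2 + s i)"
      using 2 s0[of i] by (subst (asm) ennreal_le_iff) auto
    then have "(a - ((s i)\<^sup>2 + s i)) / (1 + s i) \<le> v i"
      using s0[of i] by (simp add: field_simps)
    moreover have "v i \<le> (1 + s i) * a + ((s i)\<^sup>2 + s i)"
      using 1 2 s0[of i] a by (subst (asm) 2, subst (asm) ennreal_le_iff) auto
    ultimately show ?case using 2 by auto
  qed
  have hi: "((\<lambda>i. (1 + s i) * a + ((s i)\<^sup>2 + s i)) \<longlongrightarrow> (1 + 0) * a + (0\<^sup>2 + 0)) F"
    by (intro tendsto_intros s_lim)
  have lo: "((\<lambda>i. (a - ((s i)\<^sup>2 + s i)) / (1 + s i)) \<longlongrightarrow> (a - (0\<^sup>2 + 0)) / (1 + 0)) F"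
    by (intro tendsto_intros s_lim) auto
  have "(v \<longlongrightarrow> a) F"
  proof (rule tendsto_sandwich)
    show "((\<lambda>i. (a - ((s i)\<^sup>2 + s i)) / (1 + s i)) \<longlongrightarrow> a) F" using lo by simp
    show "((\<lambda>i. (1 + s i) * a + ((s i)\<^sup>2 + s i)) \<longlongrightarrow> a) F" using hi by simp
  qed (use both in \<open>auto elim: eventually_mono\<close>)
  then have "((\<lambda>i. ennreal (v i)) \<longlongrightarrow> ennreal a) F" by (rule tendsto_ennrealI)
  then show ?thesis
    unfolding a(1) by (rule Lim_transform_eventually) (use both in \<open>auto elim: eventually_mono\<close>)
qed

subsection \<open>Plancherel's theorem for functions of bounded support\<close>

text \<open>The plain integral formula. It is the Fourier transform for integrable \<open>f\<close>;
  otherwise the Bochner integral takes its default value 0.\<close>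

definition ft :: "('a::euclidean_space \<Rightarrow> complex) \<Rightarrow> 'a \<Rightarrow> complex" where
  "ft f \<xi> = (LINT x|lborel. cis (- 2 * pi * (x \<bullet> \<xi>)) * f x)"

lemma ft_measurable [measurable]:
  assumes [measurable]: "f \<in> borel_measurable borel"
  shows "ft f \<in> borel_measurable borel"
  unfolding ft_def by measurable

lemma integrable_cis_mult:
  assumes "integrable M f" and [measurable]: "g \<in> borel_measurable M"
  shows "integrable M (\<lambda>x. cis (g x) * f x)"
  using assms(1) by (rule Bochner_Integration.integrable_bound) (use assms(1) in \<open>auto simp: norm_mult\<close>)

lemma integrable_ft_kernel: "integrable lborel f \<Longrightarrow> integrable lborel (\<lambda>x. cis (- 2 * pi * (x \<bullet> \<xi>)) * f x)"
  by (rule integrable_cis_mult) auto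

lemma norm_ft_le: "cmod (ft f \<xi>) \<le> (LINT x|lborel. cmod (f x))"
  unfolding ft_def by (rule order_trans[OF integral_norm_bound]) (simp add: norm_mult)

lemma ft_diff:
  assumes "integrable lborel f" "integrable lborel g"
  shows "ft (\<lambda>x. f x - g x) \<xi> = ft f \<xi> - ft g \<xi>"
  unfolding ft_def using assms[THEN integrable_ft_kernel] by (simp add: right_diff_distrib)

section \<open>The energy of a transform, damped by a Gaussian\<close>

lemma integrable_lborel_prod_mult:
  fixes f g :: "'a::euclidean_space \<Rightarrow> complex"
  assumes f: "integrable lborel f" and g: "integrable lborel g"
  shows "integrable (lborel \<Otimes>\<^sub>M lborel) (\<lambda>(x, y). f x * g y)"
proof -
  note [measurable] = borel_measurable_integrable[OF f] borel_measurable_integrable[OF g]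
  show ?thesis
    by (rule lborel_pair.Fubini_integrable) (use f g in \<open>auto simp: norm_mult\<close>)
qed

text \<open>Fubini for \<open>f x * w \<xi>\<close> times a unimodular kernel that is symmetric in
  \<open>x\<close> and \<open>\<xi>\<close>.\<close>

lemma ft_multiplication:
  assumes f: "integrable lborel f" and w: "integrable lborel w"
  shows "(LINT \<xi>|lborel. w \<xi> * ft f \<xi>) = (LINT x|lborel. f x * ft w x)"
proof -
  note [measurable] = borel_measurable_integrable[OF f] borel_measurable_integrable[OF w]
  have "integrable (lborel \<Otimes>\<^sub>M lborel) (\<lambda>p. cis (- 2 * pi * (fst p \<bullet> snd p)) * (case p of (x, \<xi>) \<Rightarrow> f x * w \<xi>))"
    by (intro integrable_cis_mult integrable_lborel_prod_mult f w) measurable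
  then have *: "integrable (lborel \<Otimes>\<^sub>M lborel) (\<lambda>(x, \<xi>). f x * (cis (- 2 * pi * (\<xi> \<bullet> x)) * w \<xi>))"
    by (simp add: case_prod_unfold mult_ac inner_commute)
  have "(LINT \<xi>|lborel. w \<xi> * ft f \<xi>) = (LINT \<xi>|lborel. LINT x|lborel. f x * (cis (- 2 * pi * (\<xi> \<bullet> x)) * w \<xi>))"
    unfolding ft_def by (subst integral_mult_right_zero[symmetric]) (simp add: mult_ac inner_commute)
  also have "\<dots> = (LINT x|lborel. LINT \<xi>|lborel. f x * (cis (- 2 * pi * (\<xi> \<bullet> x)) * w \<xi>))"
    by (rule lborel_pair.Fubini_integral[OF *])
  also have "\<dots> = (LINT x|lborel. f x * ft w x)"
    unfolding ft_def by simp
  finally show ?thesis .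
qed

text \<open>The multiplication formula with \<open>w\<close> the damped conjugate of
  \<open>ft f\<close> has the damped energy on its left side. On its right side
  \<open>ft w x\<close> is the conjugate of a Gaussian average of \<open>f\<close> around
  \<open>x\<close> at scale \<open>d\<close>, so the limit of small \<open>d\<close> can be studied
  on \<open>f\<close> itself.\<close>

lemma gaussian_smoothed_energy:
  fixes f :: "'a::euclidean_space \<Rightarrow> complex"
  assumes f: "integrable lborel f" and d: "d > 0"
  shows "(LINT \<xi>|lborel. of_real (gaussian (d *\<^sub>R \<xi>) * (cmod (ft f \<xi>))\<^sup>2))
    = (LINT x|lborel. f x * cnj (LINT u|lborel. gaussian u * f (x + d *\<^sub>R u)))"
    and "integrable lborel (\<lambda>\<xi>. gaussian (d *\<^sub>R \<xi>) * (cmod (ft f \<xi>))\<^sup>2)"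
proof -
  note [measurable] = borel_measurable_integrable[OF f]
  have g: "integrable lborel (\<lambda>\<xi>::'a. gaussian (d *\<^sub>R \<xi>))"
    using integrable_lborel_affine[OF gaussian_integrable, of d 0] d by simp
  define w where "w \<xi> = gaussian (d *\<^sub>R \<xi>) * cnj (ft f \<xi>)" for \<xi>
  have w: "integrable lborel w"
  proof (rule Bochner_Integration.integrable_bound)
    show "integrable lborel (\<lambda>\<xi>::'a. gaussian (d *\<^sub>R \<xi>) * (LINT x|lborel. cmod (f x)))"
      by (intro integrable_mult_left g)
    have "gaussian (d *\<^sub>R \<xi>) * cmod (ft f \<xi>) \<le> gaussian (d *\<^sub>R \<xi>) * (LINT x|lborel. cmod (f x))" for \<xi>
      by (intro mult_left_mono norm_ft_le) auto
    then show "AE \<xi> in lborel. norm (w \<xi>) \<le> norm (gaussian (d *\<^sub>R \<xi>) * (LINT x|lborel. cmod (f x)))"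
      by (auto simp: w_def norm_mult abs_mult intro!: AE_I2)
  qed (simp add: w_def[abs_def])
  have ww: "w \<xi> * ft f \<xi> = of_real (gaussian (d *\<^sub>R \<xi>) * (cmod (ft f \<xi>))\<^sup>2)" for \<xi>
    by (simp add: w_def complex_norm_square[unfolded of_real_power] mult_ac)
  have "integrable lborel (\<lambda>\<xi>. w \<xi> * ft f \<xi>)"
    by (rule Bochner_Integration.integrable_bound[OF integrable_mult_left[OF w, of "of_real (LINT x|lborel. cmod (f x))"]])
       (auto simp: norm_mult w_def intro!: AE_I2 mult_left_mono norm_ft_le order_trans[OF norm_ft_le])
  then have "integrable lborel (\<lambda>\<xi>. complex_of_real (gaussian (d *\<^sub>R \<xi>) * (cmod (ft f \<xi>))\<^sup>2))"
    by (simp only: ww)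
  then show "integrable lborel (\<lambda>\<xi>. gaussian (d *\<^sub>R \<xi>) * (cmod (ft f \<xi>))\<^sup>2)"
    by (simp only: complex_of_real_integrable_eq)
  \<comment> \<open>A second use of the multiplication formula, now with the Gaussian modulated by
    \<open>- x\<close>: its transform is a Gaussian kernel centred at \<open>x\<close>, and
    \<open>y = x + d u\<close> absorbs the factor \<open>d ^ DIM('a)\<close>.\<close>
  have "cnj (ft w x) = (LINT u|lborel. gaussian u * f (x + d *\<^sub>R u))" for x
  proof -
    let ?w2 = "\<lambda>\<xi>. gaussian (d *\<^sub>R \<xi>) * cis (- 2 * pi * (\<xi> \<bullet> - x))"
    have "cnj (ft w x) = (LINT \<xi>|lborel. ?w2 \<xi> * ft f \<xi>)"
      unfolding ft_def[of w] by (subst Bochner_Integration.integral_cnj[symmetric])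
        (auto intro!: Bochner_Integration.integral_cong simp: w_def cis_cnj mult_ac)
    also have "\<dots> = (LINT y|lborel. f y * ft ?w2 y)"
      by (intro ft_multiplication f gaussian_fourier_scaled d)
    also have "\<dots> = (LINT y|lborel. (gaussian ((y - x) /\<^sub>R d) / d ^ DIM('a)) * f y)"
    proof -
      have "ft ?w2 y = complex_of_real (gaussian ((y - x) /\<^sub>R d) / d ^ DIM('a))" for y
        unfolding ft_def
        by (subst gaussian_fourier_scaled(2)[OF d, symmetric])
           (auto intro!: Bochner_Integration.integral_cong simp: cis_mult algebra_simps)
      then show ?thesis by (simp add: mult_ac)
    qed
    also have "\<dots> = (LINT u|lborel. gaussian u * f (x + d *\<^sub>R u))"
      using d by (subst integral_lborel_affine[of _ d x])
        (simp_all add: scaleR_conv_of_real)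
    finally show ?thesis .
  qed
  then have "ft w x = cnj (LINT u|lborel. gaussian u * f (x + d *\<^sub>R u))" for x
    by (metis complex_cnj_cnj)
  then show "(LINT \<xi>|lborel. of_real (gaussian (d *\<^sub>R \<xi>) * (cmod (ft f \<xi>))\<^sup>2))
    = (LINT x|lborel. f x * cnj (LINT u|lborel. gaussian u * f (x + d *\<^sub>R u)))"
    using ft_multiplication[OF f w] by (simp add: ww)
qed

lemma ennreal_norm_integral_le:
  fixes f :: "'a \<Rightarrow> 'b::{banach, second_countable_topology}"
  shows "ennreal (norm (integral\<^sup>L M f)) \<le> (\<integral>\<^sup>+x. ennreal (norm (f x)) \<partial>M)"
  by (cases "integrable M f") (auto simp: not_integrable_integral_eq integral_norm_bound_ennreal)

lemma L2nn_translate: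
  fixes f :: "'a::euclidean_space \<Rightarrow> complex"
  assumes [measurable]: "f \<in> borel_measurable borel"
  shows "L2nn lborel (\<lambda>x. f (x + t)) = L2nn lborel f"
  unfolding L2nn_def
  by (subst (2) nn_integral_lborel_affine[of _ 1 t]) (auto simp: add.commute)

text \<open>The product of \<open>f x\<close> and its shifted value is split by
  \<open>ab \<le> (a^2 + b^2) / 2\<close>. By translation invariance and total Gaussian mass 1 each
  of the two terms gives the full norm, also when it is infinite.\<close>

lemma gaussian_energy_le:
  fixes f :: "'a::euclidean_space \<Rightarrow> complex"
  assumes f: "integrable lborel f" and d: "d > 0"
  shows "(\<integral>\<^sup>+\<xi>. ennreal (gaussian (d *\<^sub>R \<xi>) * (cmod (ft f \<xi>))\<^sup>2) \<partial>lborel) \<le> L2nn lborel f"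
proof -
  note [measurable] = borel_measurable_integrable[OF f]
  let ?E = "\<lambda>\<xi>. gaussian (d *\<^sub>R \<xi>) * (cmod (ft f \<xi>))\<^sup>2"
  let ?I = "\<lambda>x. LINT u|lborel. gaussian u * f (x + d *\<^sub>R u)"
  let ?N = "L2nn lborel f"
  have "(\<integral>\<^sup>+\<xi>. ennreal (?E \<xi>) \<partial>lborel) = ennreal (LINT \<xi>|lborel. ?E \<xi>)"
    by (intro nn_integral_eq_integral gaussian_smoothed_energy f d) auto
  also have "\<dots> = ennreal (cmod (LINT \<xi>|lborel. of_real (?E \<xi>)))"
    by (subst integral_complex_of_real) (auto intro!: arg_cong[of _ _ ennreal] integral_nonneg)
  also have "\<dots> = ennreal (cmod (LINT x|lborel. f x * cnj (?I x)))"
    using gaussian_smoothed_energy(1)[OF f d] by simp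
  also have "\<dots> \<le> (\<integral>\<^sup>+x. ennreal (cmod (f x * cnj (?I x))) \<partial>lborel)"
    by (rule ennreal_norm_integral_le)
  also have "\<dots> = (\<integral>\<^sup>+x. ennreal (cmod (f x)) * ennreal (cmod (?I x)) \<partial>lborel)"
    by (simp add: norm_mult ennreal_mult)
  also have "\<dots> \<le> (\<integral>\<^sup>+x. ennreal (cmod (f x)) * (\<integral>\<^sup>+u. ennreal (cmod (gaussian u * f (x + d *\<^sub>R u))) \<partial>lborel) \<partial>lborel)"
    by (intro nn_integral_mono mult_left_mono ennreal_norm_integral_le) auto
  also have "\<dots> = (\<integral>\<^sup>+x. \<integral>\<^sup>+u. ennreal (gaussian u * (cmod (f x) * cmod (f (x + d *\<^sub>R u)))) \<partial>lborel \<partial>lborel)"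
    by (subst nn_integral_cmult[symmetric]) (auto simp: norm_mult mult_ac simp flip: ennreal_mult)
  also have "\<dots> \<le> (\<integral>\<^sup>+x. \<integral>\<^sup>+u. ennreal (1/2) * (ennreal (gaussian u) * ennreal ((cmod (f x))\<^sup>2)
      + ennreal (gaussian u) * ennreal ((cmod (f (x + d *\<^sub>R u)))\<^sup>2)) \<partial>lborel \<partial>lborel)"
  proof (intro nn_integral_mono)
    fix x u
    let ?a = "cmod (f x)" and ?b = "cmod (f (x + d *\<^sub>R u))"
    have "?a * ?b \<le> (?a\<^sup>2 + ?b\<^sup>2) / 2"
      using sum_squares_bound[of ?a ?b] by simp
    then have "gaussian u * (?a * ?b) \<le> gaussian u * ((?a\<^sup>2 + ?b\<^sup>2) / 2)"
      by (intro mult_left_mono) auto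
    also have "\<dots> = 1/2 * (gaussian u * ?a\<^sup>2 + gaussian u * ?b\<^sup>2)"
      by (simp add: algebra_simps)
    finally have "ennreal (gaussian u * (?a * ?b)) \<le> ennreal (1/2 * (gaussian u * ?a\<^sup>2 + gaussian u * ?b\<^sup>2))"
      by (rule ennreal_leI)
    also have "\<dots> = ennreal (1/2) * (ennreal (gaussian u) * ennreal (?a\<^sup>2) + ennreal (gaussian u) * ennreal (?b\<^sup>2))"
      by (subst ennreal_mult, simp, simp, subst ennreal_plus) (auto simp: ennreal_mult)
    finally show "ennreal (gaussian u * (?a * ?b)) \<le> \<dots>" .
  qed
  also have "\<dots> = ennreal (1/2) * ((\<integral>\<^sup>+x. \<integral>\<^sup>+u. ennreal (gaussian (u::'a)) * ennreal ((cmod (f x))\<^sup>2) \<partial>lborel \<partial>lborel)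
     + (\<integral>\<^sup>+x. \<integral>\<^sup>+u. ennreal (gaussian u) * ennreal ((cmod (f (x + d *\<^sub>R u)))\<^sup>2) \<partial>lborel \<partial>lborel))"
    by (simp add: nn_integral_cmult nn_integral_add)
  also have "(\<integral>\<^sup>+x. \<integral>\<^sup>+u. ennreal (gaussian (u::'a)) * ennreal ((cmod (f x))\<^sup>2) \<partial>lborel \<partial>lborel) = ?N"
    by (simp add: nn_integral_multc gaussian_nn_integral L2nn_def)
  also have "(\<integral>\<^sup>+x. \<integral>\<^sup>+u. ennreal (gaussian u) * ennreal ((cmod (f (x + d *\<^sub>R u)))\<^sup>2) \<partial>lborel \<partial>lborel)
     = (\<integral>\<^sup>+u. \<integral>\<^sup>+x. ennreal (gaussian u) * ennreal ((cmod (f (x + d *\<^sub>R u)))\<^sup>2) \<partial>lborel \<partial>lborel)"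
    by (rule lborel_pair.Fubini') measurable
  also have "\<dots> = (\<integral>\<^sup>+u. ennreal (gaussian u) * L2nn lborel (\<lambda>x. f (x + d *\<^sub>R u)) \<partial>lborel)"
    by (simp add: nn_integral_cmult L2nn_def)
  also have "\<dots> = ?N"
    by (simp add: L2nn_translate nn_integral_multc gaussian_nn_integral)
  also have "ennreal (1/2) * (?N + ?N) = ?N"
  proof -
    have "ennreal (1/2) * (?N + ?N) = ennreal (1/2) * (ennreal 2 * ?N)" by (simp add: mult_2)
    also have "\<dots> = ?N" by (subst mult.assoc[symmetric], subst ennreal_mult[symmetric]) auto
    finally show ?thesis .
  qed
  finally show ?thesis .
qed

lemma gaussian_small_scale: "(\<lambda>n. gaussian ((1 / real (Suc n)) *\<^sub>R \<xi>)) \<longlonglongrightarrow> 1"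
proof -
  have "(\<lambda>n. exp (- pi * (((1 / real (Suc n)) *\<^sub>R \<xi>) \<bullet> ((1 / real (Suc n)) *\<^sub>R \<xi>))))
      \<longlonglongrightarrow> exp (- pi * ((0 *\<^sub>R \<xi>) \<bullet> (0 *\<^sub>R \<xi>)))"
    by (intro tendsto_intros LIMSEQ_Suc[OF lim_1_over_n])
  then show ?thesis by (simp add: gaussian_def)
qed

text \<open>Fatou's lemma along the scales \<open>1 / (n + 1)\<close>, where the damping factor
  tends to 1 pointwise.\<close>

lemma L2nn_ft_le:
  fixes f :: "'a::euclidean_space \<Rightarrow> complex"
  assumes f: "integrable lborel f"
  shows "L2nn lborel (ft f) \<le> L2nn lborel f"
proof -
  note [measurable] = borel_measurable_integrable[OF f]
  let ?E = "\<lambda>n \<xi>. ennreal (gaussian ((1 / real (Suc n)) *\<^sub>R \<xi>) * (cmod (ft f \<xi>))\<^sup>2)"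
  have lim: "(\<lambda>n. ?E n \<xi>) \<longlonglongrightarrow> ennreal (1 * (cmod (ft f \<xi>))\<^sup>2)" for \<xi>
    by (intro tendsto_ennrealI tendsto_mult gaussian_small_scale tendsto_const)
  have "liminf (\<lambda>n. ?E n \<xi>) = ennreal ((cmod (ft f \<xi>))\<^sup>2)" for \<xi>
    using lim_imp_Liminf[OF sequentially_bot lim] by (simp only: mult_1)
  then have "L2nn lborel (ft f) = (\<integral>\<^sup>+\<xi>. liminf (\<lambda>n. ?E n \<xi>) \<partial>lborel)"
    by (simp only: L2nn_def)
  also have "\<dots> \<le> liminf (\<lambda>n. \<integral>\<^sup>+\<xi>. ?E n \<xi> \<partial>lborel)"
    by (intro nn_integral_liminf) measurable
  also have "\<dots> \<le> L2nn lborel f"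
    by (intro Liminf_le always_eventually allI gaussian_energy_le f) auto
  finally show ?thesis .
qed

text \<open>The missing inequality. Continuity makes the Gaussian averages of \<open>h\<close>
  converge at every point and the bound \<open>B\<close> dominates them, so the damped energies
  converge to the norm of \<open>h\<close>; being damped, they never exceed the norm of
  \<open>ft h\<close>.\<close>

lemma L2nn_ft_continuous:
  fixes h :: "'a::euclidean_space \<Rightarrow> complex"
  assumes cont: "continuous_on UNIV h" and bnd: "\<And>x. cmod (h x) \<le> B" and h: "integrable lborel h"
    and h2: "h \<in> L2 lborel"
  shows "L2nn lborel (ft h) = L2nn lborel h"
proof (rule antisym[OF L2nn_ft_le[OF h]])
  note [measurable] = borel_measurable_integrable[OF h]
  define d where "d n = 1 / real (Suc n)" for n
  have d: "d n > 0" "d \<longlonglongrightarrow> 0" for n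
    using LIMSEQ_Suc[OF lim_1_over_n] by (auto simp: d_def[abs_def])
  let ?I = "\<lambda>n x. LINT u|lborel. gaussian u * h (x + d n *\<^sub>R u)"
  have B: "B \<ge> 0" using bnd[of 0] norm_ge_zero order_trans by blast
  have Ib: "cmod (?I n x) \<le> B" for n x
  proof -
    have gb: "integrable lborel (\<lambda>u::'a. B * gaussian u)"
      by (intro integrable_mult_right gaussian_integrable)
    have b: "cmod (gaussian u * h (x + d n *\<^sub>R u)) \<le> B * gaussian u" for u
      using mult_left_mono[OF bnd, of "gaussian u"] by (simp add: norm_mult mult_ac)
    have "integrable lborel (\<lambda>u. gaussian u * h (x + d n *\<^sub>R u))"
      by (rule Bochner_Integration.integrable_bound[OF gb])
        (use b B in \<open>auto intro!: AE_I2\<close>)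
    then have "(LINT u|lborel. cmod (gaussian u * h (x + d n *\<^sub>R u))) \<le> (LINT u|lborel. B * gaussian (u::'a))"
      by (intro Bochner_Integration.integral_mono gb b integrable_norm)
    with integral_norm_bound have "cmod (?I n x) \<le> (LINT u|lborel. B * gaussian (u::'a))"
      by (rule order_trans)
    also have "\<dots> = B" by (simp add: gaussian_integral)
    finally show ?thesis .
  qed
  have Ilim: "(\<lambda>n. ?I n x) \<longlonglongrightarrow> h x" for x
  proof -
    have "(\<lambda>n. ?I n x) \<longlonglongrightarrow> (LINT u|lborel. complex_of_real (gaussian (u::'a)) * h x)"
    proof (rule integral_dominated_convergence[where w = "\<lambda>u. B * gaussian u"])
      show "integrable lborel (\<lambda>u::'a. B * gaussian u)"
        by (intro integrable_mult_right gaussian_integrable)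
      show "AE u in lborel. (\<lambda>n. gaussian u * h (x + d n *\<^sub>R u)) \<longlonglongrightarrow> gaussian u * h x"
      proof (intro AE_I2)
        fix u
        have "(\<lambda>n. x + d n *\<^sub>R u) \<longlonglongrightarrow> x + 0 *\<^sub>R u" by (intro tendsto_intros d)
        then have "(\<lambda>n. x + d n *\<^sub>R u) \<longlonglongrightarrow> x" by simp
        moreover have "isCont h x"
          using cont by (simp add: continuous_on_eq_continuous_at)
        ultimately have "(\<lambda>n. h (x + d n *\<^sub>R u)) \<longlonglongrightarrow> h x"
          by (rule isCont_tendsto_compose[rotated])
        then show "(\<lambda>n. gaussian u * h (x + d n *\<^sub>R u)) \<longlonglongrightarrow> gaussian u * h x"
          by (intro tendsto_intros)
      qed
      show "AE u in lborel. cmod (gaussian u * h (x + d n *\<^sub>R u)) \<le> B * gaussian u" for n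
        using bnd by (auto simp: norm_mult mult_ac intro!: AE_I2)
    qed measurable
    then show ?thesis
      by (simp add: gaussian_integral)
  qed
  have "(\<lambda>n. LINT x|lborel. h x * cnj (?I n x)) \<longlonglongrightarrow> (LINT x|lborel. h x * cnj (h x))"
  proof (rule integral_dominated_convergence[where w = "\<lambda>x. B * cmod (h x)"])
    show "integrable lborel (\<lambda>x. B * cmod (h x))" using h by simp
    show "AE x in lborel. (\<lambda>n. h x * cnj (?I n x)) \<longlonglongrightarrow> h x * cnj (h x)"
      by (intro AE_I2 tendsto_intros Ilim)
    show "AE x in lborel. cmod (h x * cnj (?I n x)) \<le> B * cmod (h x)" for n
      by (intro AE_I2, subst norm_mult, subst mult.commute, unfold complex_mod_cnj,
          intro mult_right_mono Ib norm_ge_zero)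
  qed measurable
  then have "(\<lambda>n. LINT \<xi>|lborel. complex_of_real (gaussian (d n *\<^sub>R \<xi>) * (cmod (ft h \<xi>))\<^sup>2))
      \<longlonglongrightarrow> (LINT x|lborel. complex_of_real ((cmod (h x))\<^sup>2))"
    using gaussian_smoothed_energy(1)[OF h d(1)] by (simp only: complex_norm_square)
  then have "(\<lambda>n. LINT \<xi>|lborel. gaussian (d n *\<^sub>R \<xi>) * (cmod (ft h \<xi>))\<^sup>2)
      \<longlonglongrightarrow> (LINT x|lborel. (cmod (h x))\<^sup>2)"
    by (simp only: integral_complex_of_real tendsto_of_real_iff)
  then have "(\<lambda>n. ennreal (LINT \<xi>|lborel. gaussian (d n *\<^sub>R \<xi>) * (cmod (ft h \<xi>))\<^sup>2))
      \<longlonglongrightarrow> L2nn lborel h"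
    using L2D(4)[OF h2] by (auto simp: L2_normsq_def intro!: tendsto_ennrealI)
  moreover have "ennreal (LINT \<xi>|lborel. gaussian (d n *\<^sub>R \<xi>) * (cmod (ft h \<xi>))\<^sup>2) \<le> L2nn lborel (ft h)" for n
  proof -
    have "ennreal (LINT \<xi>|lborel. gaussian (d n *\<^sub>R \<xi>) * (cmod (ft h \<xi>))\<^sup>2)
        = (\<integral>\<^sup>+\<xi>. ennreal (gaussian (d n *\<^sub>R \<xi>) * (cmod (ft h \<xi>))\<^sup>2) \<partial>lborel)"
      by (intro nn_integral_eq_integral[symmetric] gaussian_smoothed_energy h d) auto
    also have "\<dots> \<le> L2nn lborel (ft h)"
      unfolding L2nn_def
      by (intro nn_integral_mono ennreal_leI mult_left_le_one_le) auto
    finally show ?thesis .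
  qed
  ultimately show "L2nn lborel h \<le> L2nn lborel (ft h)"
    by (intro LIMSEQ_le_const2) auto
qed

section \<open>Density: from continuous functions to all square integrable functions of bounded
  support\<close>

lemma L2_bounded_support_integrable:
  fixes f :: "'a::euclidean_space \<Rightarrow> complex"
  assumes f: "f \<in> L2 lborel" and supp: "\<And>x. x \<notin> cball c r \<Longrightarrow> f x = 0"
  shows "integrable lborel f"
proof (rule Bochner_Integration.integrable_bound)
  show "integrable lborel (\<lambda>x. (cmod (f x))\<^sup>2 + indicat_real (cball c r) x)"
    using L2D(2)[OF f]
    by (intro Bochner_Integration.integrable_add integrable_real_indicator)
      (auto simp: emeasure_lborel_cball_finite[unfolded infinity_ennreal_def])
  show "AE x in lborel. norm (f x) \<le> norm ((cmod (f x))\<^sup>2 + indicat_real (cball c r) x)"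
  proof (intro AE_I2)
    fix x
    \<comment> \<open>The constant 1 is paid for by the indicator of the ball, which has finite
      measure.\<close>
    have "a \<le> a\<^sup>2 + 1" for a :: real
      using zero_le_power2[of "a - 1/2"] by (simp add: power2_eq_square algebra_simps)
    then show "norm (f x) \<le> norm ((cmod (f x))\<^sup>2 + indicat_real (cball c r) x)"
      using supp[of x] by (cases "x \<in> cball c r") auto
  qed
qed (use L2D[OF f] in auto)

text \<open>The contraction property applied to \<open>u n - f\<close> shows that the transforms
  converge too, so the equality of norms survives the limit.\<close>

lemma plancherel_limit:
  fixes f :: "'a::euclidean_space \<Rightarrow> complex" and u :: "nat \<Rightarrow> 'a \<Rightarrow> complex"
  assumes f: "integrable lborel f" "f \<in> L2 lborel"
    and u: "\<And>n. integrable lborel (u n)" "\<And>n. L2nn lborel (ft (u n)) = L2nn lborel (u n)"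
    and lim: "(\<lambda>n. L2nn lborel (\<lambda>x. u n x - f x)) \<longlonglongrightarrow> 0"
  shows "L2nn lborel (ft f) = L2nn lborel f"
proof -
  note [measurable] = borel_measurable_integrable[OF f(1)] borel_measurable_integrable[OF u(1)]
  have ft: "ft f \<in> L2 lborel"
    by (rule L2I) (use L2nn_ft_le[OF f(1)] L2D(3)[OF f(2)] in auto)
  have "(\<lambda>n. L2nn lborel (\<lambda>\<xi>. ft (u n) \<xi> - ft f \<xi>)) \<longlonglongrightarrow> 0"
  proof (rule tendsto_sandwich[OF _ _ tendsto_const lim])
    show "\<forall>\<^sub>F n in sequentially. L2nn lborel (\<lambda>\<xi>. ft (u n) \<xi> - ft f \<xi>) \<le> L2nn lborel (\<lambda>x. u n x - f x)"
      using L2nn_ft_le[OF Bochner_Integration.integrable_diff[OF u(1) f(1)]]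
      by (simp add: ft_diff[OF u(1) f(1), abs_def] always_eventually)
  qed auto
  then have "(\<lambda>n. L2nn lborel (ft (u n))) \<longlonglongrightarrow> L2nn lborel (ft f)"
    by (intro L2nn_tendsto ft) auto
  moreover have "(\<lambda>n. L2nn lborel (u n)) \<longlonglongrightarrow> L2nn lborel f"
    by (intro L2nn_tendsto f lim) auto
  ultimately show ?thesis
    unfolding u(2) by (rule LIMSEQ_unique)
qed

text \<open>For \<open>k > 0\<close> this is the radial projection onto the closed disc of radius
  \<open>k\<close>: continuous, and the identity on the disc.\<close>

definition clip :: "real \<Rightarrow> complex \<Rightarrow> complex" where
  "clip k z = z /\<^sub>R max 1 (cmod z / k)"

lemma norm_clip: "k > 0 \<Longrightarrow> cmod (clip k z) \<le> k" "cmod (clip k z) \<le> cmod z"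
proof -
  let ?m = "max 1 (cmod z / k)"
  have m: "?m \<ge> 1" "?m > 0" by auto
  have c: "cmod (clip k z) = cmod z / ?m"
    using m by (simp add: clip_def divide_inverse mult.commute)
  show "cmod (clip k z) \<le> cmod z"
    unfolding c using divide_left_mono[OF m(1), of "cmod z"] by simp
  assume "k > 0"
  then have "cmod z \<le> k * ?m" by (simp add: max_def field_simps)
  then show "cmod (clip k z) \<le> k"
    unfolding c by (subst pos_divide_le_eq[OF m(2)])
qed

lemma clip_id: "k > 0 \<Longrightarrow> cmod z \<le> k \<Longrightarrow> clip k z = z"
  by (auto simp: clip_def max_def field_simps)

lemma continuous_clip: "k > 0 \<Longrightarrow> continuous_on UNIV (clip k)"
  unfolding clip_def by (intro continuous_intros) auto

lemma L2nn_dominated: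
  fixes u :: "nat \<Rightarrow> 'a \<Rightarrow> complex"
  assumes [measurable]: "\<And>n. u n \<in> borel_measurable M" "f \<in> borel_measurable M"
    and w: "integrable M w"
    and bound: "\<And>n x. (cmod (u n x - f x))\<^sup>2 \<le> w x"
    and lim: "AE x in M. (\<lambda>n. u n x) \<longlonglongrightarrow> f x"
  shows "(\<lambda>n. L2nn M (\<lambda>x. u n x - f x)) \<longlonglongrightarrow> 0"
proof -
  have [measurable]: "w \<in> borel_measurable M" using w by auto
  have "w x \<ge> 0" for x
    using bound[of 0 x] zero_le_power2 order_trans by blast
  then have "(\<integral>\<^sup>+x. ennreal (w x) \<partial>M) < \<infinity>"
    using w by (simp add: integrable_iff_bounded)
  then have "(\<lambda>n. L2nn M (\<lambda>x. u n x - f x)) \<longlonglongrightarrow> (\<integral>\<^sup>+x. 0 \<partial>M)"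
    unfolding L2nn_def
  proof (intro nn_integral_dominated_convergence[where w = "\<lambda>x. ennreal (w x)"])
    show "AE x in M. (\<lambda>n. ennreal ((cmod (u n x - f x))\<^sup>2)) \<longlonglongrightarrow> 0"
      using lim
    proof eventually_elim
      case (elim x)
      then have "(\<lambda>n. (cmod (u n x - f x))\<^sup>2) \<longlonglongrightarrow> (cmod (f x - f x))\<^sup>2"
        by (intro tendsto_intros)
      then show ?case using tendsto_ennrealI by fastforce
    qed
  qed (auto intro!: AE_I2 ennreal_leI bound)
  then show ?thesis by simp
qed

text \<open>A measurable \<open>f\<close> is almost everywhere a limit of continuous functions.
  Clipping these at \<open>k\<close> and multiplying by a continuous cutoff keeps continuity and
  adds a common bound and support, as dominated convergence requires.\<close>

lemma plancherel_bounded: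
  fixes f :: "'a::euclidean_space \<Rightarrow> complex"
  assumes [measurable]: "f \<in> borel_measurable borel" and bnd: "\<And>x. cmod (f x) \<le> k"
    and k: "k > 0" and supp: "\<And>x. x \<notin> cball 0 r \<Longrightarrow> f x = 0"
  shows "L2nn lborel (ft f) = L2nn lborel f"
proof -
  \<comment> \<open>Descends linearly from 1 to 0 between the radii \<open>r\<close> and
    \<open>r + 1\<close>: continuous, yet equal to 1 wherever \<open>f\<close> may be
    nonzero.\<close>
  define cut where "cut x = max 0 (min 1 (r + 1 - norm x))" for x :: 'a
  have cut: "0 \<le> cut x" "cut x \<le> 1" "x \<notin> cball 0 (r + 1) \<Longrightarrow> cut x = 0" "x \<in> cball 0 r \<Longrightarrow> cut x = 1" for x
    by (auto simp: cut_def)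
  have "f \<in> borel_measurable lebesgue"
    by (intro measurable_completion) simp
  then have "f measurable_on UNIV"
    by (simp add: measurable_on_iff_borel_measurable)
  then obtain N g where N: "negligible N" and g: "\<And>n::nat. continuous_on UNIV (g n)"
    and lim: "\<And>x. x \<notin> N \<Longrightarrow> (\<lambda>n. g n x) \<longlonglongrightarrow> f x"
    by (auto simp: measurable_on_def)
  \<comment> \<open>\<open>N\<close> is null for the completed measure only and need not be Borel,
    so the exceptional set is brought back to \<open>lborel\<close>.\<close>
  have AEN: "AE x in lborel. x \<notin> N"
  proof -
    have "AE x in lebesgue. x \<notin> N"
      using N by (intro AE_not_in) (simp add: negligible_iff_null_sets)
    then show ?thesis by (simp add: AE_completion_iff)
  qed
  define u where "u n x = of_real (cut x) * clip k (g n x)" for n x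
  have ucont: "continuous_on UNIV (u n)" for n
    unfolding u_def cut_def
    by (intro continuous_intros continuous_on_compose2[OF continuous_clip[OF k] g]) auto
  then have [measurable]: "u n \<in> borel_measurable borel" for n
    by (rule borel_measurable_continuous_onI)
  have ub: "cmod (u n x) \<le> k" for n x
  proof -
    have "cut x * cmod (clip k (g n x)) \<le> 1 * k"
      using cut[of x] k by (intro mult_mono norm_clip) auto
    then show ?thesis using cut[of x] by (simp add: u_def norm_mult)
  qed
  have us: "u n x = 0" if "x \<notin> cball 0 (r + 1)" for n x
    using cut(3)[OF that] by (simp add: u_def)
  have ball: "integrable lborel (\<lambda>x::'a. B * indicat_real (cball 0 s) x)" for B s
    by (intro integrable_mult_right integrable_real_indicator) (auto simp: emeasure_lborel_cball_finite[unfolded infinity_ennreal_def])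
  have sq: "integrable lborel (\<lambda>x. (cmod (h x))\<^sup>2)"
    if [measurable]: "h \<in> borel_measurable borel" and "\<And>x. cmod (h x) \<le> k" "\<And>x. x \<notin> cball 0 s \<Longrightarrow> h x = 0"
    for h :: "'a \<Rightarrow> complex" and s
    by (rule Bochner_Integration.integrable_bound[OF ball[of "k\<^sup>2" s]])
       (use that in \<open>auto intro!: AE_I2 power_mono simp: indicator_def\<close>)
  have f2: "f \<in> L2 lborel" and u2: "u n \<in> L2 lborel" for n
    using sq[OF _ bnd supp] sq[OF _ ub us] by (auto simp: L2_def)
  show ?thesis
  proof (rule plancherel_limit[of f u])
    show "integrable lborel f" by (rule L2_bounded_support_integrable[OF f2 supp])
    show "integrable lborel (u n)" for n by (rule L2_bounded_support_integrable[OF u2 us])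
    then show "L2nn lborel (ft (u n)) = L2nn lborel (u n)" for n
      by (intro L2nn_ft_continuous[OF ucont ub] u2)
    show "(\<lambda>n. L2nn lborel (\<lambda>x. u n x - f x)) \<longlonglongrightarrow> 0"
    proof (rule L2nn_dominated[OF _ _ ball[of "(2 * k)\<^sup>2" "r + 1"]])
      show "(cmod (u n x - f x))\<^sup>2 \<le> (2 * k)\<^sup>2 * indicat_real (cball 0 (r + 1)) x" for n x
      proof (cases "x \<in> cball 0 (r + 1)")
        case True
        have "cmod (u n x - f x) \<le> 2 * k"
          using norm_triangle_ineq4[of "u n x" "f x"] ub[of n x] bnd[of x] by linarith
        then have "(cmod (u n x - f x))\<^sup>2 \<le> (2 * k)\<^sup>2" by (intro power_mono) auto
        with True show ?thesis by simp
      next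
        case False
        then have "x \<notin> cball 0 r" by auto
        with False show ?thesis using us supp by simp
      qed
      show "AE x in lborel. (\<lambda>n. u n x) \<longlonglongrightarrow> f x"
        using AEN
      proof eventually_elim
        case (elim x)
        have "(\<lambda>n. clip k (g n x)) \<longlonglongrightarrow> clip k (f x)"
          using continuous_clip[OF k] lim[OF elim]
          by (intro isCont_tendsto_compose[of "f x" "clip k"]) (simp_all add: continuous_on_eq_continuous_at)
        then have "(\<lambda>n. u n x) \<longlonglongrightarrow> of_real (cut x) * f x"
          unfolding u_def clip_id[OF k bnd] by (intro tendsto_intros)
        moreover have "of_real (cut x) * f x = f x"
          using cut(4) supp by (cases "x \<in> cball 0 r") auto
        ultimately show ?case by simp
      qed
    qed auto
  qed fact
qed

text \<open>Clipping at height \<open>n + 1\<close> reduces to bounded functions: at each point the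
  clipped values are eventually equal to \<open>f x\<close>, and \<open>4 |f|^2\<close> dominates
  the squared errors.\<close>

theorem plancherel_bounded_support:
  fixes f :: "'a::euclidean_space \<Rightarrow> complex"
  assumes f: "f \<in> L2 lborel" and supp: "\<And>x. x \<notin> cball 0 r \<Longrightarrow> f x = 0"
  shows "L2nn lborel (ft f) = L2nn lborel f"
proof -
  define u where "u n x = clip (real (Suc n)) (f x)" for n x
  have clip_measurable [measurable]: "clip (real (Suc n)) \<in> borel_measurable borel" for n
    by (intro borel_measurable_continuous_onI continuous_clip) auto
  note [measurable] = L2D(1)[OF f]
  have [measurable]: "u n \<in> borel_measurable borel" for n
    unfolding u_def by measurable
  have us: "u n x = 0" if "x \<notin> cball 0 r" for n x
    using supp[OF that] by (simp add: u_def clip_def)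
  have uf: "cmod (u n x) \<le> cmod (f x)" for n x
    by (simp add: u_def norm_clip)
  have u2: "u n \<in> L2 lborel" for n
    unfolding L2_def
    by (auto intro!: Bochner_Integration.integrable_bound[OF L2D(2)[OF f]] AE_I2 power_mono uf)
  show ?thesis
  proof (rule plancherel_limit[of f u])
    show "integrable lborel f" by (rule L2_bounded_support_integrable[OF f supp])
    show "integrable lborel (u n)" for n by (rule L2_bounded_support_integrable[OF u2 us])
    show "L2nn lborel (ft (u n)) = L2nn lborel (u n)" for n
      by (rule plancherel_bounded[of _ "real (Suc n)" r]) (use us in \<open>auto simp: u_def norm_clip\<close>)
    show "(\<lambda>n. L2nn lborel (\<lambda>x. u n x - f x)) \<longlonglongrightarrow> 0"
    proof (rule L2nn_dominated[where w = "\<lambda>x. 4 * (cmod (f x))\<^sup>2"])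
      show "integrable lborel (\<lambda>x. 4 * (cmod (f x))\<^sup>2)" using L2D(2)[OF f] by simp
      show "(cmod (u n x - f x))\<^sup>2 \<le> 4 * (cmod (f x))\<^sup>2" for n x
      proof -
        have "cmod (u n x - f x) \<le> 2 * cmod (f x)"
          using norm_triangle_ineq4[of "u n x" "f x"] uf[of n x] by linarith
        then have "(cmod (u n x - f x))\<^sup>2 \<le> (2 * cmod (f x))\<^sup>2" by (intro power_mono) auto
        then show ?thesis by (simp add: power_mult_distrib)
      qed
      show "AE x in lborel. (\<lambda>n. u n x) \<longlonglongrightarrow> f x"
      proof (intro AE_I2 tendsto_eventually)
        fix x
        obtain n0 where n0: "cmod (f x) \<le> real n0" using real_arch_simple by blast
        show "\<forall>\<^sub>F n in sequentially. u n x = f x"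
          using eventually_ge_at_top[of n0]
          by eventually_elim (use n0 in \<open>auto simp: u_def intro!: clip_id\<close>)
      qed
    qed auto
  qed fact
qed

subsection \<open>The Fourier transform on \<open>L\<^sup>2\<close>\<close>

text \<open>Has the indicator form of a set integral, so that \<open>ft (trunc S f)\<close> matches
  the integrals over balls in \<open>has_L2_fourier\<close>.\<close>

definition trunc :: "'a set \<Rightarrow> ('a \<Rightarrow> complex) \<Rightarrow> 'a \<Rightarrow> complex" where
  "trunc S f x = indicator S x *\<^sub>R f x"

lemma trunc_apply: "trunc S f x = (if x \<in> S then f x else 0)"
  by (simp add: trunc_def)

lemma trunc_measurable [measurable]:
  "f \<in> borel_measurable M \<Longrightarrow> S \<in> sets M \<Longrightarrow> trunc S f \<in> borel_measurable M"
  unfolding trunc_def[abs_def] by (intro borel_measurable_scaleR borel_measurable_indicator)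

lemma trunc_L2: "f \<in> L2 M \<Longrightarrow> S \<in> sets M \<Longrightarrow> trunc S f \<in> L2 M"
  unfolding L2_def
  by (auto intro!: Bochner_Integration.integrable_bound[where f = "\<lambda>x. (cmod (f x))\<^sup>2"] AE_I2 simp: trunc_apply)

lemma trunc_cball_L2: "f \<in> L2 lborel \<Longrightarrow> trunc (cball c r) f \<in> L2 lborel"
  by (intro trunc_L2) auto

lemma trunc_cball_integrable:
  fixes f :: "'a::euclidean_space \<Rightarrow> complex"
  shows "f \<in> L2 lborel \<Longrightarrow> integrable lborel (trunc (cball c r) f)"
  by (rule L2_bounded_support_integrable[OF trunc_cball_L2]) (auto simp: trunc_apply)

lemma tendsto_trunc_cball:
  fixes f :: "'a::euclidean_space \<Rightarrow> complex"
  assumes f: "f \<in> L2 lborel"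
  shows "((\<lambda>R. L2nn lborel (\<lambda>x. trunc (cball c R) f x - f x)) \<longlongrightarrow> 0) at_top"
\<comment> \<open>Dominated convergence concerns sequences, so the limit in a real radius is tested
  along every sequence of radii tending to infinity.\<close>
proof (rule tendsto_at_topI_sequentially)
  fix X :: "nat \<Rightarrow> real" assume X: "filterlim X at_top sequentially"
  note [measurable] = L2D(1)[OF f]
  show "(\<lambda>n. L2nn lborel (\<lambda>x. trunc (cball c (X n)) f x - f x)) \<longlonglongrightarrow> 0"
  proof (rule L2nn_dominated[where w = "\<lambda>x. (cmod (f x))\<^sup>2"])
    show "AE x in lborel. (\<lambda>n. trunc (cball c (X n)) f x) \<longlonglongrightarrow> f x"
    proof (intro AE_I2 tendsto_eventually)
      fix x
      have "\<forall>\<^sub>F n in sequentially. dist c x \<le> X n"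
        using X by (simp add: filterlim_at_top)
      then show "\<forall>\<^sub>F n in sequentially. trunc (cball c (X n)) f x = f x"
        by eventually_elim (simp add: trunc_apply)
    qed
  qed (use L2D(2)[OF f] in \<open>auto simp: trunc_apply\<close>)
qed

lemma has_L2_fourier_iff:
  "has_L2_fourier f g \<longleftrightarrow> f \<in> L2 lborel \<and> g \<in> L2 lborel \<and>
     ((\<lambda>R. L2nn lborel (\<lambda>\<xi>. ft (trunc (cball 0 R) f) \<xi> - g \<xi>)) \<longlongrightarrow> 0) at_top"
  unfolding has_L2_fourier_def L2_tendsto_L2nn ft_def set_lebesgue_integral_def trunc_def
  by (simp add: scaleR_conv_of_real mult_ac)

lemma L2nn_plancherel_diff:
  fixes f g :: "'a::euclidean_space \<Rightarrow> complex"
  assumes f: "f \<in> L2 lborel" and g: "g \<in> L2 lborel"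
    and "\<And>x. x \<notin> cball 0 r \<Longrightarrow> f x = 0" "\<And>x. x \<notin> cball 0 r \<Longrightarrow> g x = 0"
  shows "L2nn lborel (\<lambda>\<xi>. ft f \<xi> - ft g \<xi>) = L2nn lborel (\<lambda>x. f x - g x)"
proof -
  have i: "integrable lborel f" "integrable lborel g"
    using L2_bounded_support_integrable[of f 0 r] L2_bounded_support_integrable[of g 0 r] assms by auto
  then have "L2nn lborel (\<lambda>\<xi>. ft f \<xi> - ft g \<xi>) = L2nn lborel (ft (\<lambda>x. f x - g x))"
    by (simp add: ft_diff[OF i, abs_def])
  also have "\<dots> = L2nn lborel (\<lambda>x. f x - g x)"
    using assms by (intro plancherel_bounded_support[of _ r] L2_diff) auto
  finally show ?thesis .
qed

lemma L2nn_add_le_2: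
  assumes "f \<in> borel_measurable M" "g \<in> borel_measurable M"
  shows "L2nn M (\<lambda>x. f x + g x) \<le> 2 * L2nn M f + 2 * L2nn M g"
  using L2nn_add_le[OF assms, of 1] by simp

lemma tendsto_L2nn_add:
  assumes "\<And>i. u i \<in> borel_measurable M" "\<And>i. v i \<in> borel_measurable M"
    and "((\<lambda>i. L2nn M (u i)) \<longlongrightarrow> 0) F" "((\<lambda>i. L2nn M (v i)) \<longlongrightarrow> 0) F"
  shows "((\<lambda>i. L2nn M (\<lambda>x. u i x + v i x)) \<longlongrightarrow> 0) F"
proof (rule tendsto_sandwich[OF _ _ tendsto_const])
  have "((\<lambda>i. 2 * L2nn M (u i) + 2 * L2nn M (v i)) \<longlongrightarrow> 2 * 0 + 2 * 0) F"
    by (intro tendsto_add ennreal_tendsto_cmult assms) auto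
  then show "((\<lambda>i. 2 * L2nn M (u i) + 2 * L2nn M (v i)) \<longlongrightarrow> 0) F" by simp
qed (use assms in \<open>auto intro!: always_eventually L2nn_add_le_2\<close>)

lemma tendsto_L2nn_cmult:
  assumes "\<And>i. u i \<in> borel_measurable M" "((\<lambda>i. L2nn M (u i)) \<longlongrightarrow> 0) F"
  shows "((\<lambda>i. L2nn M (\<lambda>x. c * u i x)) \<longlongrightarrow> 0) F"
proof -
  have "((\<lambda>i. ennreal ((cmod c)\<^sup>2) * L2nn M (u i)) \<longlongrightarrow> ennreal ((cmod c)\<^sup>2) * 0) F"
    by (intro ennreal_tendsto_cmult assms) auto
  then show ?thesis using assms(1) by (simp add: L2nn_cmult)
qed

text \<open>By Plancherel the transforms of two truncations are exactly as far apart as the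
  truncations, and both of these tend to \<open>f\<close>.\<close>

lemma has_L2_fourier_any_centre:
  fixes f g :: "'a::euclidean_space \<Rightarrow> complex"
  assumes "has_L2_fourier f g"
  shows "((\<lambda>R. L2nn lborel (\<lambda>\<xi>. ft (trunc (cball c R) f) \<xi> - g \<xi>)) \<longlongrightarrow> 0) at_top"
proof -
  have f: "f \<in> L2 lborel" and g: "g \<in> L2 lborel"
    and lim: "((\<lambda>R. L2nn lborel (\<lambda>\<xi>. ft (trunc (cball 0 R) f) \<xi> - g \<xi>)) \<longlongrightarrow> 0) at_top"
    using assms by (auto simp: has_L2_fourier_iff)
  note [measurable] = L2D(1)[OF f] L2D(1)[OF g]
  have [measurable]: "trunc (cball b R) f \<in> borel_measurable borel" for b R
    using trunc_measurable[of f lborel "cball b R"] by simp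
  let ?t = "\<lambda>b R. trunc (cball b R) f"
  have "L2nn lborel (\<lambda>\<xi>. ft (?t c R) \<xi> - ft (?t 0 R) \<xi>)
      = L2nn lborel (\<lambda>x. (?t c R x - f x) + (-1) * (?t 0 R x - f x))" for R
  proof -
    \<comment> \<open>One ball around the origin that contains both supports; the absolute value
      covers negative radii.\<close>
    have "x \<notin> cball 0 (\<bar>R\<bar> + norm c) \<Longrightarrow> x \<notin> cball 0 R \<and> x \<notin> cball c R" for x
      using norm_triangle_ineq2[of x c] norm_ge_zero[of c]
      unfolding mem_cball dist_norm norm_minus_commute[of c] by (simp, linarith)
    then show ?thesis
      using f by (subst L2nn_plancherel_diff[of _ _ "\<bar>R\<bar> + norm c"])
        (auto intro!: trunc_cball_L2 simp: trunc_apply)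
  qed
  moreover have "((\<lambda>R. L2nn lborel (\<lambda>x. (?t c R x - f x) + (-1) * (?t 0 R x - f x))) \<longlongrightarrow> 0) at_top"
    by (intro tendsto_L2nn_add tendsto_L2nn_cmult tendsto_trunc_cball f) measurable
  ultimately have "((\<lambda>R. L2nn lborel (\<lambda>\<xi>. ft (?t c R) \<xi> - ft (?t 0 R) \<xi>)) \<longlongrightarrow> 0) at_top" by simp
  from tendsto_L2nn_add[OF _ _ this lim] show ?thesis by simp
qed

text \<open>Plancherel for every transform pair: the norms of the transformed truncations tend to
  both sides.\<close>

lemma has_L2_fourier_L2nn:
  fixes f g :: "'a::euclidean_space \<Rightarrow> complex"
  assumes "has_L2_fourier f g"
  shows "L2nn lborel g = L2nn lborel f"
proof -
  have f: "f \<in> L2 lborel" and g: "g \<in> L2 lborel"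
    and lim: "((\<lambda>R. L2nn lborel (\<lambda>\<xi>. ft (trunc (cball 0 R) f) \<xi> - g \<xi>)) \<longlongrightarrow> 0) at_top"
    using assms by (auto simp: has_L2_fourier_iff)
  note [measurable] = L2D(1)[OF f]
  have [measurable]: "trunc (cball b R) f \<in> borel_measurable borel" for b R
    using trunc_measurable[of f lborel "cball b R"] by simp
  have "L2nn lborel (ft (trunc (cball 0 R) f)) = L2nn lborel (trunc (cball 0 R) f)" for R
    by (intro plancherel_bounded_support[of _ R] trunc_cball_L2 f) (simp add: trunc_apply)
  moreover have "((\<lambda>R. L2nn lborel (trunc (cball 0 R) f)) \<longlongrightarrow> L2nn lborel f) at_top"
    by (intro L2nn_tendsto tendsto_trunc_cball f) measurable
  ultimately have "((\<lambda>R. L2nn lborel (ft (trunc (cball 0 R) f))) \<longlongrightarrow> L2nn lborel f) at_top"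
    by simp
  moreover have "((\<lambda>R. L2nn lborel (ft (trunc (cball 0 R) f))) \<longlongrightarrow> L2nn lborel g) at_top"
    by (intro L2nn_tendsto g lim) measurable
  ultimately show ?thesis
    by (intro tendsto_unique[OF trivial_limit_at_top_linorder])
qed

lemma ft_trunc_measurable:
  "f \<in> L2 lborel \<Longrightarrow> ft (trunc (cball c R) f) \<in> borel_measurable borel"
  using borel_measurable_integrable[OF trunc_cball_integrable, of f c R] by (intro ft_measurable) simp

section \<open>Linearity, translation and inversion\<close>

lemma has_L2_fourier_add:
  assumes 1: "has_L2_fourier f g" and 2: "has_L2_fourier f' g'"
  shows "has_L2_fourier (\<lambda>x. f x + f' x) (\<lambda>\<xi>. g \<xi> + g' \<xi>)"
proof -
  have L: "f \<in> L2 lborel" "f' \<in> L2 lborel" "g \<in> L2 lborel" "g' \<in> L2 lborel"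
    using assms by (auto simp: has_L2_fourier_iff)
  note [measurable] = L[THEN L2D(1)] L(1,2)[THEN ft_trunc_measurable]
  have "ft (trunc S (\<lambda>x. f x + f' x)) \<xi> = ft (trunc S f) \<xi> + ft (trunc S f') \<xi>"
    if "S = cball 0 R" for S R \<xi>
    using L(1,2)[THEN trunc_cball_integrable, THEN integrable_ft_kernel, of \<xi> 0 R]
    unfolding ft_def that by (simp add: trunc_def algebra_simps flip: Bochner_Integration.integral_add)
  then have "L2nn lborel (\<lambda>\<xi>. ft (trunc (cball 0 R) (\<lambda>x. f x + f' x)) \<xi> - (g \<xi> + g' \<xi>))
    = L2nn lborel (\<lambda>\<xi>. (ft (trunc (cball 0 R) f) \<xi> - g \<xi>) + (ft (trunc (cball 0 R) f') \<xi> - g' \<xi>))" for R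
    by (simp add: algebra_simps)
  then show ?thesis
    using assms L by (auto simp: has_L2_fourier_iff intro!: L2_add tendsto_L2nn_add)
qed

lemma has_L2_fourier_cmult:
  assumes "has_L2_fourier f g"
  shows "has_L2_fourier (\<lambda>x. c * f x) (\<lambda>\<xi>. c * g \<xi>)"
proof -
  have L: "f \<in> L2 lborel" "g \<in> L2 lborel"
    using assms by (auto simp: has_L2_fourier_iff)
  note [measurable] = L[THEN L2D(1)] L(1)[THEN ft_trunc_measurable]
  have *: "cis t * trunc S (\<lambda>x. c * f x) x = c * (cis t * trunc S f x)" for S x t
    by (simp add: trunc_def mult_ac)
  have "ft (trunc S (\<lambda>x. c * f x)) \<xi> = c * ft (trunc S f) \<xi>" for S \<xi>
    unfolding ft_def * by simp
  then have "L2nn lborel (\<lambda>\<xi>. ft (trunc (cball 0 R) (\<lambda>x. c * f x)) \<xi> - c * g \<xi>)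
    = L2nn lborel (\<lambda>\<xi>. c * (ft (trunc (cball 0 R) f) \<xi> - g \<xi>))" for R
    by (simp add: algebra_simps)
  then show ?thesis
    using assms L by (auto simp: has_L2_fourier_iff intro!: L2_cmult tendsto_L2nn_cmult)
qed

lemma has_L2_fourier_diff:
  assumes "has_L2_fourier f g" "has_L2_fourier f' g'"
  shows "has_L2_fourier (\<lambda>x. f x - f' x) (\<lambda>\<xi>. g \<xi> - g' \<xi>)"
  using has_L2_fourier_add[OF assms(1) has_L2_fourier_cmult[OF assms(2), of "-1"]] by simp

lemma has_L2_fourier_sum:
  assumes "finite I" "\<And>i. i \<in> I \<Longrightarrow> has_L2_fourier (f i) (g i)"
  shows "has_L2_fourier (\<lambda>x. \<Sum>i\<in>I. c i * f i x) (\<lambda>\<xi>. \<Sum>i\<in>I. c i * g i \<xi>)"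
  using assms
proof (induction I rule: finite_induct)
  case empty
  have "ft (trunc S (\<lambda>x. 0)) \<xi> = 0" for S :: "'b set" and \<xi>
    by (simp add: ft_def trunc_def)
  then show ?case by (simp add: has_L2_fourier_iff L2nn_def)
next
  case (insert i I)
  then show ?case by (auto intro!: has_L2_fourier_add has_L2_fourier_cmult)
qed

lemma ft_translate:
  assumes [measurable]: "f \<in> borel_measurable borel"
  shows "ft (\<lambda>x. f (x - a)) \<xi> = cis (- 2 * pi * (a \<bullet> \<xi>)) * ft f \<xi>"
proof -
  have *: "cis (- 2 * pi * ((a + 1 *\<^sub>R x) \<bullet> \<xi>)) * f (a + 1 *\<^sub>R x - a)
      = cis (- 2 * pi * (a \<bullet> \<xi>)) * (cis (- 2 * pi * (x \<bullet> \<xi>)) * f x)" for x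
    by (simp add: cis_mult inner_add_left distrib_left flip: mult.assoc)
  have "ft (\<lambda>x. f (x - a)) \<xi>
      = (LINT x|lborel. cis (- 2 * pi * ((a + 1 *\<^sub>R x) \<bullet> \<xi>)) * f (a + 1 *\<^sub>R x - a))"
    using integral_lborel_affine[of "\<lambda>x. cis (- 2 * pi * (x \<bullet> \<xi>)) * f (x - a)" 1 a]
    by (simp add: ft_def)
  then show ?thesis
    unfolding * by (simp add: ft_def)
qed

text \<open>Truncating the translate at a ball around 0 amounts to translating the truncation of
  \<open>f\<close> at the ball around \<open>- a\<close>; the unimodular factor then drops out of
  the norm.\<close>

lemma has_L2_fourier_translate:
  assumes fg: "has_L2_fourier f g"
  shows "has_L2_fourier (\<lambda>x. f (x - a)) (\<lambda>\<xi>. cis (- 2 * pi * (\<xi> \<bullet> a)) * g \<xi>)"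
proof -
  have L: "f \<in> L2 lborel" "g \<in> L2 lborel"
    using fg by (auto simp: has_L2_fourier_iff)
  note [measurable] = L[THEN L2D(1)]
  have [measurable]: "trunc (cball b R) f \<in> borel_measurable borel" for b R
    using trunc_measurable[of f lborel "cball b R"] by simp
  have "(\<lambda>x. f (x - a)) \<in> L2 lborel"
    using L2nn_translate[of f "- a"] L2D(3)[OF L(1)] by (intro L2I) auto
  moreover have "(\<lambda>\<xi>. cis (- 2 * pi * (\<xi> \<bullet> a)) * g \<xi>) \<in> L2 lborel"
    using L2D(3)[OF L(2)] by (intro L2I) (auto simp: L2nn_def norm_mult)
  moreover have "ft (trunc (cball 0 R) (\<lambda>x. f (x - a))) \<xi> - cis (- 2 * pi * (\<xi> \<bullet> a)) * g \<xi>
     = cis (- 2 * pi * (\<xi> \<bullet> a)) * (ft (trunc (cball (- a) R) f) \<xi> - g \<xi>)" for R \<xi>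
  proof -
    have "trunc (cball 0 R) (\<lambda>x. f (x - a)) = (\<lambda>x. trunc (cball (- a) R) f (x - a))"
      by (auto simp: trunc_apply dist_norm fun_eq_iff norm_minus_commute)
    then show ?thesis
      by (simp add: ft_translate algebra_simps inner_commute)
  qed
  ultimately show ?thesis
    using has_L2_fourier_any_centre[OF fg, of "- a"]
    by (simp add: has_L2_fourier_iff L2nn_def norm_mult)
qed

text \<open>The inverse transform of \<open>G\<close>: by the multiplication formula the cross term in
  \<open>\<parallel>F (trunc f) - G\<parallel>\<^sup>2\<close> equals \<open>\<parallel>trunc f\<parallel>\<^sup>2\<close>, so only \<open>\<parallel>f\<parallel>\<^sup>2 - \<parallel>trunc f\<parallel>\<^sup>2\<close> is left.\<close>

lemma has_L2_fourier_inverse: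
  fixes G :: "'a::euclidean_space \<Rightarrow> complex"
  assumes G: "G \<in> L2 lborel" and supp: "\<And>x. x \<notin> cball 0 r \<Longrightarrow> G x = 0"
  shows "has_L2_fourier (\<lambda>x. cnj (ft (\<lambda>\<xi>. cnj (G \<xi>)) x)) G"
proof -
  \<comment> \<open>Conjugating before and after \<open>ft\<close> reverses the sign in the
    exponent, so \<open>f\<close> is the inverse Fourier integral of \<open>G\<close> expressed by
    the forward one.\<close>
  define H where "H \<xi> = cnj (G \<xi>)" for \<xi>
  define f where "f x = cnj (ft H x)" for x
  note [measurable] = L2D(1)[OF G]
  have H: "H \<in> L2 lborel"
    using L2D(2)[OF G] by (auto simp: L2_def H_def[abs_def])
  then have Hi: "integrable lborel H"
    by (rule L2_bounded_support_integrable[of _ 0 r]) (simp add: H_def supp)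
  note [measurable] = L2D(1)[OF H]
  have nH: "L2nn lborel H = L2nn lborel G" by (simp add: L2nn_def H_def)
  have nf: "L2nn lborel f = L2nn lborel G"
  proof -
    have "L2nn lborel f = L2nn lborel (ft H)" by (simp add: L2nn_def f_def)
    also have "\<dots> = L2nn lborel H"
      by (rule plancherel_bounded_support[OF H, of r]) (simp add: H_def supp)
    finally show ?thesis using nH by simp
  qed
  have f: "f \<in> L2 lborel"
    using L2D(3)[OF G] nf by (intro L2I) (auto simp: f_def[abs_def])
  note [measurable] = L2D(1)[OF f]
  have "L2nn lborel (\<lambda>\<xi>. ft (trunc (cball 0 R) f) \<xi> - G \<xi>) = L2nn lborel (\<lambda>x. trunc (cball 0 R) f x - f x)" for R
  proof -
    let ?t = "trunc (cball 0 R) f"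
    let ?u = "ft ?t"
    have t: "?t \<in> L2 lborel" "integrable lborel ?t"
      using f by (auto intro: trunc_cball_L2 trunc_cball_integrable)
    note [measurable] = L2D(1)[OF t(1)]
    have nu: "L2nn lborel ?u = L2nn lborel ?t"
      by (intro plancherel_bounded_support[of _ R] t) (simp add: trunc_apply)
    have u: "?u \<in> L2 lborel"
      using L2D(3)[OF t(1)] nu ft_trunc_measurable[OF f] by (intro L2I) auto
    have norms: "L2_normsq lborel ?u = L2_normsq lborel ?t" "L2_normsq lborel G = L2_normsq lborel f"
      using nu nf L2D(4)[OF u] L2D(4)[OF t(1)] L2D(4)[OF f] L2D(4)[OF G]
      by (auto simp: L2_normsq_def)
    have cross_int: "integrable lborel (\<lambda>\<xi>. H \<xi> * ?u \<xi>)"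
    proof (rule Bochner_Integration.integrable_bound)
      show "integrable lborel (\<lambda>\<xi>. (cmod (?u \<xi>))\<^sup>2 + (cmod (H \<xi>))\<^sup>2)"
        using L2D(2)[OF u] L2D(2)[OF H] by simp
      have "a * b \<le> b\<^sup>2 + a\<^sup>2" if "a \<ge> 0" "b \<ge> 0" for a b :: real
        using sum_squares_bound[of a b] mult_nonneg_nonneg[OF that] by linarith
      then show "AE \<xi> in lborel. norm (H \<xi> * ?u \<xi>) \<le> norm ((cmod (?u \<xi>))\<^sup>2 + (cmod (H \<xi>))\<^sup>2)"
        by (auto simp: norm_mult intro!: AE_I2)
    qed (use ft_trunc_measurable[OF f] in measurable)
    have "(LINT \<xi>|lborel. H \<xi> * ?u \<xi>) = (LINT x|lborel. ?t x * ft H x)"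
      by (rule ft_multiplication[OF t(2) Hi])
    also have "\<dots> = (LINT x|lborel. complex_of_real ((cmod (?t x))\<^sup>2))"
      by (intro Bochner_Integration.integral_cong refl)
        (simp add: trunc_apply f_def complex_norm_square mult.commute del: of_real_power)
    also have "\<dots> = complex_of_real (L2_normsq lborel ?t)"
      by (simp add: L2_normsq_def del: of_real_power)
    finally have crossC: "(LINT \<xi>|lborel. H \<xi> * ?u \<xi>) = complex_of_real (L2_normsq lborel ?t)" .
    define c where "c \<xi> = Re (H \<xi> * ?u \<xi>)" for \<xi>
    have c: "integrable lborel c" unfolding c_def by (rule integrable_Re[OF cross_int])
    have cross: "(LINT \<xi>|lborel. c \<xi>) = L2_normsq lborel ?t"
      unfolding c_def Bochner_Integration.integral_Re[OF cross_int] crossC by simp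
    have sq: "(cmod (a - b))\<^sup>2 = (cmod a)\<^sup>2 - 2 * Re (cnj b * a) + (cmod b)\<^sup>2" for a b :: complex
      unfolding cmod_power2 by (simp add: power2_eq_square algebra_simps)
    have "L2_normsq lborel (\<lambda>\<xi>. ?u \<xi> - G \<xi>)
       = L2_normsq lborel ?u - 2 * (LINT \<xi>|lborel. c \<xi>) + L2_normsq lborel G"
      using L2D(2)[OF u] L2D(2)[OF G] c
      unfolding L2_normsq_def sq H_def[symmetric] c_def[symmetric] by simp
    also have "\<dots> = L2_normsq lborel f - L2_normsq lborel ?t"
      by (simp add: cross norms)
    also have "\<dots> = (LINT x|lborel. (cmod (f x))\<^sup>2 - (cmod (?t x))\<^sup>2)"
      using L2D(2)[OF f] L2D(2)[OF t(1)] by (simp add: L2_normsq_def)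
    \<comment> \<open>At each point \<open>?t x\<close> is \<open>f x\<close> or 0, so the
      difference of the squares is the square of the difference.\<close>
    also have "\<dots> = L2_normsq lborel (\<lambda>x. ?t x - f x)"
      unfolding L2_normsq_def by (intro Bochner_Integration.integral_cong) (auto simp: trunc_apply)
    finally show ?thesis
      using L2D(4)[OF L2_diff[OF u G]] L2D(4)[OF L2_diff[OF t(1) f]] by simp
  qed
  then have "has_L2_fourier f G"
    using tendsto_trunc_cball[OF f, of 0] f G by (simp add: has_L2_fourier_iff)
  then show ?thesis by (simp add: f_def[abs_def] H_def[abs_def])
qed

subsection \<open>Transfer of Riesz bases\<close>

lemma L2_normsq_mono:
  assumes "f \<in> L2 M" "g \<in> L2 N" "L2nn M f \<le> ennreal K * L2nn N g" "K > 0"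
  shows "L2_normsq M f \<le> K * L2_normsq N g"
proof -
  have "0 \<le> L2_normsq N g" by (simp add: L2_normsq_def)
  then show ?thesis
    using assms(3,4) L2D(4)[OF assms(1)] L2D(4)[OF assms(2)] by (simp flip: ennreal_mult)
qed

text \<open>Coefficients that expand \<open>h\<close> also expand \<open>f\<close> by the error
  comparison, and the norm comparison changes the constants to \<open>C1 / K\<close> and
  \<open>K * C2\<close>. One partner \<open>h\<close> for each \<open>f\<close> suffices, since
  \<open>riesz_basis\<close> asserts only that coefficients exist.\<close>

lemma riesz_basis_transfer:
  assumes K: "K > 0"
    and corr: "\<And>f. f \<in> V \<Longrightarrow> \<exists>h\<in>W. f \<in> L2 M \<and> h \<in> L2 N \<and>
        L2nn M f \<le> ennreal K * L2nn N h \<and> L2nn N h \<le> ennreal K * L2nn M f \<and>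
        (\<forall>c F. finite F \<longrightarrow> L2nn M (\<lambda>x. (\<Sum>a\<in>F. c a * u a x) - f x)
            \<le> ennreal K * L2nn N (\<lambda>x. (\<Sum>a\<in>F. c a * v a x) - h x))"
    and basis: "riesz_basis N W A v"
  shows "riesz_basis M V A u"
proof -
  obtain C1 C2 where C: "C1 > 0" "C2 > 0" and ex: "\<And>h. h \<in> W \<Longrightarrow> \<exists>c.
      (\<lambda>a. (cmod (c a))\<^sup>2) summable_on A \<and>
      L2_tendsto N (\<lambda>F x. \<Sum>a\<in>F. c a * v a x) h (finite_subsets_at_top A) \<and>
      C1 * (\<Sum>\<^sub>\<infinity>a\<in>A. (cmod (c a))\<^sup>2) \<le> L2_normsq N h \<and>
      L2_normsq N h \<le> C2 * (\<Sum>\<^sub>\<infinity>a\<in>A. (cmod (c a))\<^sup>2)"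
    using basis unfolding riesz_basis_def by blast
  show ?thesis
    unfolding riesz_basis_def
  proof (rule exI[of _ "C1 / K"], rule exI[of _ "K * C2"], intro conjI ballI)
    show "C1 / K > 0" "K * C2 > 0" using C K by auto
    fix f assume "f \<in> V"
    then obtain h where h: "h \<in> W" "f \<in> L2 M" "h \<in> L2 N" "L2nn M f \<le> ennreal K * L2nn N h"
        "L2nn N h \<le> ennreal K * L2nn M f"
      and cmp: "\<And>c F. finite F \<Longrightarrow> L2nn M (\<lambda>x. (\<Sum>a\<in>F. c a * u a x) - f x)
            \<le> ennreal K * L2nn N (\<lambda>x. (\<Sum>a\<in>F. c a * v a x) - h x)"
      using corr by blast
    obtain c where c: "(\<lambda>a. (cmod (c a))\<^sup>2) summable_on A"
        "L2_tendsto N (\<lambda>F x. \<Sum>a\<in>F. c a * v a x) h (finite_subsets_at_top A)"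
        "C1 * (\<Sum>\<^sub>\<infinity>a\<in>A. (cmod (c a))\<^sup>2) \<le> L2_normsq N h"
        "L2_normsq N h \<le> C2 * (\<Sum>\<^sub>\<infinity>a\<in>A. (cmod (c a))\<^sup>2)"
      using ex[OF h(1)] by blast
    let ?S = "\<Sum>\<^sub>\<infinity>a\<in>A. (cmod (c a))\<^sup>2"
    have n1: "L2_normsq M f \<le> K * L2_normsq N h" and n2: "L2_normsq N h \<le> K * L2_normsq M f"
      using L2_normsq_mono[OF h(2,3,4) K] L2_normsq_mono[OF h(3,2,5) K] by this
    show "\<exists>c. (\<lambda>a. (cmod (c a))\<^sup>2) summable_on A \<and>
          L2_tendsto M (\<lambda>F x. \<Sum>a\<in>F. c a * u a x) f (finite_subsets_at_top A) \<and>
          C1 / K * (\<Sum>\<^sub>\<infinity>a\<in>A. (cmod (c a))\<^sup>2) \<le> L2_normsq M f \<and>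
          L2_normsq M f \<le> K * C2 * (\<Sum>\<^sub>\<infinity>a\<in>A. (cmod (c a))\<^sup>2)"
    proof (intro exI[of _ c] conjI)
      show "C1 / K * ?S \<le> L2_normsq M f"
        using order_trans[OF c(3) n2] K by (simp add: field_simps)
      show "L2_normsq M f \<le> K * C2 * ?S"
        using order_trans[OF n1 mult_left_mono[OF c(4)]] K by (simp add: mult.assoc)
      show "L2_tendsto M (\<lambda>F x. \<Sum>a\<in>F. c a * u a x) f (finite_subsets_at_top A)"
        unfolding L2_tendsto_L2nn
      proof (rule tendsto_sandwich[OF _ _ tendsto_const])
        show "\<forall>\<^sub>F F in finite_subsets_at_top A. L2nn M (\<lambda>x. (\<Sum>a\<in>F. c a * u a x) - f x)
            \<le> ennreal K * L2nn N (\<lambda>x. (\<Sum>a\<in>F. c a * v a x) - h x)"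
          by (intro eventually_finite_subsets_at_top_weakI cmp)
        have "((\<lambda>F. ennreal K * L2nn N (\<lambda>x. (\<Sum>a\<in>F. c a * v a x) - h x)) \<longlongrightarrow> ennreal K * 0)
            (finite_subsets_at_top A)"
          using c(2) unfolding L2_tendsto_L2nn by (intro ennreal_tendsto_cmult) auto
        then show "((\<lambda>F. ennreal K * L2nn N (\<lambda>x. (\<Sum>a\<in>F. c a * v a x) - h x)) \<longlongrightarrow> 0)
            (finite_subsets_at_top A)" by simp
      qed auto
    qed (use c in auto)
  qed
qed

text \<open>The difference of the two is a transform of \<open>f - f\<close>, hence has norm 0 by
  Plancherel.\<close>

lemma has_L2_fourier_unique:
  assumes "has_L2_fourier f g" "has_L2_fourier f g'"
  shows "AE \<xi> in lborel. g \<xi> = g' \<xi>"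
proof -
  have L: "g \<in> L2 lborel" "g' \<in> L2 lborel"
    using assms by (auto simp: has_L2_fourier_iff)
  note [measurable] = L[THEN L2D(1)]
  have "L2nn lborel (\<lambda>\<xi>. g \<xi> - g' \<xi>) = 0"
    using has_L2_fourier_L2nn[OF has_L2_fourier_diff[OF assms]] by (simp add: L2nn_def)
  then have "AE \<xi> in lborel. ennreal ((cmod (g \<xi> - g' \<xi>))\<^sup>2) = 0"
    unfolding L2nn_def by (subst nn_integral_0_iff_AE[symmetric]) auto
  then show ?thesis by eventually_elim simp
qed

section \<open>Functions on a subset, extension by zero and multipliers\<close>

lemma L2nn_restrict_space:
  assumes "S \<in> sets M"
  shows "L2nn (restrict_space M S) f = L2nn M (trunc S f)"
proof -
  have "S \<inter> space M \<in> sets M" using assms sets.sets_into_space by (metis inf.absorb1)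
  then show ?thesis
    unfolding L2nn_def
    by (subst nn_integral_restrict_space) (auto simp: trunc_apply intro!: nn_integral_cong split: split_indicator)
qed

lemma restrict_space_measurable_trunc:
  assumes "S \<in> sets M"
  shows "f \<in> borel_measurable (restrict_space M S) \<longleftrightarrow> trunc S f \<in> borel_measurable M"
proof -
  have "S \<inter> space M \<in> sets M" using assms sets.sets_into_space by (metis inf.absorb1)
  then show ?thesis
    unfolding trunc_def[abs_def] by (subst borel_measurable_restrict_space_iff) (auto simp: mult.commute)
qed

lemma L2_restrict_space_iff:
  "S \<in> sets M \<Longrightarrow> f \<in> L2 (restrict_space M S) \<longleftrightarrow> trunc S f \<in> L2 M"
  by (simp add: L2_iff L2nn_restrict_space restrict_space_measurable_trunc)

text \<open>Multiplication by \<open>p\<close> is bounded by \<open>B\<close>, division by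
  \<open>p\<close> by \<open>1 / m\<close>. The function \<open>w\<close> is prescribed almost
  everywhere only, because it will be a Fourier transform.\<close>

lemma L2nn_multiplier:
  assumes S: "S \<in> sets M"
    and h: "h \<in> borel_measurable (restrict_space M S)"
    and m: "m > 0" "\<And>x. x \<in> S \<Longrightarrow> m \<le> cmod (p x)" and B: "\<And>x. x \<in> S \<Longrightarrow> cmod (p x) \<le> B"
    and w: "AE x in M. w x = (if x \<in> S then p x * h x else 0)"
  shows "L2nn M w \<le> ennreal (B\<^sup>2) * L2nn (restrict_space M S) h"
    and "L2nn (restrict_space M S) h \<le> ennreal (1 / m\<^sup>2) * L2nn M w"
proof -
  have [measurable]: "trunc S h \<in> borel_measurable M"
    using h S by (simp add: restrict_space_measurable_trunc)
  have eq: "L2nn M w = L2nn M (\<lambda>x. if x \<in> S then p x * h x else 0)"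
    unfolding L2nn_def using w by (intro nn_integral_cong_AE) auto
  also have "\<dots> \<le> L2nn M (\<lambda>x. of_real B * trunc S h x)"
    unfolding L2nn_def
    by (intro nn_integral_mono ennreal_leI power_mono)
      (auto simp: trunc_apply norm_mult intro!: mult_right_mono order_trans[OF B])
  also have "\<dots> = ennreal (B\<^sup>2) * L2nn M (trunc S h)"
    by (subst L2nn_cmult) auto
  finally show "L2nn M w \<le> ennreal (B\<^sup>2) * L2nn (restrict_space M S) h"
    using S by (simp add: L2nn_restrict_space)
  have "ennreal (m\<^sup>2) * L2nn M (trunc S h) = L2nn M (\<lambda>x. of_real m * trunc S h x)"
    by (subst L2nn_cmult) auto
  also have "\<dots> \<le> L2nn M w"
    unfolding L2nn_def eq[unfolded L2nn_def]
    by (intro nn_integral_mono ennreal_leI power_mono)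
      (use m in \<open>auto simp: trunc_apply norm_mult intro!: mult_right_mono\<close>)
  finally have "ennreal (1 / m\<^sup>2) * (ennreal (m\<^sup>2) * L2nn M (trunc S h)) \<le> ennreal (1 / m\<^sup>2) * L2nn M w"
    by (rule mult_left_mono) auto
  moreover have "ennreal (1 / m\<^sup>2) * ennreal (m\<^sup>2) = 1"
    using m(1) by (simp flip: ennreal_mult)
  ultimately show "L2nn (restrict_space M S) h \<le> ennreal (1 / m\<^sup>2) * L2nn M w"
    using S by (simp add: L2nn_restrict_space flip: mult.assoc)
qed

theorem corollary1p4:
  fixes \<Omega> A :: "'a::euclidean_space set"
    and \<phi> \<phi>hat :: "'a \<Rightarrow> complex"
  assumes "\<Omega> \<in> sets borel" and "0 < emeasure lborel \<Omega>" and "emeasure lborel \<Omega> < \<infinity>"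
    and "countable A"
    and "\<phi> \<in> PW \<Omega>"
    and "has_L2_fourier \<phi> \<phi>hat"
    and "continuous_on \<Omega> \<phi>hat" and "\<forall>\<xi>\<in>\<Omega>. \<phi>hat \<xi> \<noteq> 0"
    and "compact \<Omega>"
  shows "riesz_basis lborel (PW \<Omega>) A (\<lambda>a x. \<phi> (x - a)) \<longleftrightarrow>
         riesz_basis (restrict_space lborel \<Omega>) (L2 (restrict_space lborel \<Omega>)) A
           (\<lambda>a x. cis (- 2 * pi * (x \<bullet> a)))"
proof -
  note hat = assms(6)
  define M where "M = restrict_space lborel \<Omega>"
  have \<Omega>: "\<Omega> \<in> sets lborel" using assms(1) by simp
  have "\<Omega> \<noteq> {}" using assms(2) by auto
  have ccont: "continuous_on \<Omega> (\<lambda>\<xi>. cmod (\<phi>hat \<xi>))"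
    using assms(7) by (intro continuous_intros)
  \<comment> \<open>The lower bound is positive because it is attained at a point of \<Omega>, where
    \<open>\<phi>hat\<close> does not vanish.\<close>
  obtain \<xi>0 where \<xi>0: "\<xi>0 \<in> \<Omega>" "\<And>\<xi>. \<xi> \<in> \<Omega> \<Longrightarrow> cmod (\<phi>hat \<xi>0) \<le> cmod (\<phi>hat \<xi>)"
    using continuous_attains_inf[OF assms(9) \<open>\<Omega> \<noteq> {}\<close> ccont] by blast
  obtain \<xi>1 where \<xi>1: "\<And>\<xi>. \<xi> \<in> \<Omega> \<Longrightarrow> cmod (\<phi>hat \<xi>) \<le> cmod (\<phi>hat \<xi>1)"
    using continuous_attains_sup[OF assms(9) \<open>\<Omega> \<noteq> {}\<close> ccont] by blast
  define m where "m = cmod (\<phi>hat \<xi>0)"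
  define B where "B = cmod (\<phi>hat \<xi>1)"
  \<comment> \<open>Squares, since squared norms are compared; the maximum serves multiplication and
    division by \<open>\<phi>hat\<close> alike.\<close>
  define K where "K = max (B\<^sup>2) (1 / m\<^sup>2)"
  have m: "m > 0" "\<And>\<xi>. \<xi> \<in> \<Omega> \<Longrightarrow> m \<le> cmod (\<phi>hat \<xi>)" and B: "\<And>\<xi>. \<xi> \<in> \<Omega> \<Longrightarrow> cmod (\<phi>hat \<xi>) \<le> B"
    using \<xi>0 \<xi>1 assms(8) by (auto simp: m_def B_def)
  have K: "K > 0" using m(1) by (simp add: K_def less_max_iff_disj)
  obtain r where r: "\<Omega> \<subseteq> cball 0 r"
    using compact_imp_bounded[OF assms(9)] by (meson bounded_subset_ballD ball_subset_cball order_trans)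
  have L: "\<phi> \<in> L2 lborel" "\<phi>hat \<in> L2 lborel"
    using hat by (auto simp: has_L2_fourier_iff)
  note [measurable] = L[THEN L2D(1)]
  \<comment> \<open>Membership in \<open>PW \<Omega>\<close> yields some transform vanishing off
    \<Omega>; uniqueness carries this over to the given \<open>\<phi>hat\<close>.\<close>
  obtain g0 where g0: "has_L2_fourier \<phi> g0" "AE \<xi> in lborel. \<xi> \<notin> \<Omega> \<longrightarrow> g0 \<xi> = 0"
    using assms(5) by (auto simp: PW_def)
  have hat0: "AE \<xi> in lborel. \<xi> \<notin> \<Omega> \<longrightarrow> \<phi>hat \<xi> = 0"
    using has_L2_fourier_unique[OF hat g0(1)] g0(2) by eventually_elim simp
  \<comment> \<open>The correspondence that divides a transform of \<open>f\<close> by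
    \<open>\<phi>hat\<close> on \<Omega>, as a relation so that both directions of the equivalence
    share the same estimates.\<close>
  define T where "T f h \<longleftrightarrow> h \<in> borel_measurable M \<and>
      (\<exists>g. has_L2_fourier f g \<and> (AE \<xi> in lborel. g \<xi> = (if \<xi> \<in> \<Omega> then \<phi>hat \<xi> * h \<xi> else 0)))" for f h
  have T_norms: "L2nn lborel f \<le> ennreal K * L2nn M h" "L2nn M h \<le> ennreal K * L2nn lborel f"
    if "T f h" for f h
  proof -
    obtain g where h: "h \<in> borel_measurable M" and g: "has_L2_fourier f g"
      "AE \<xi> in lborel. g \<xi> = (if \<xi> \<in> \<Omega> then \<phi>hat \<xi> * h \<xi> else 0)"
      using \<open>T f h\<close> by (auto simp: T_def)
    note mult = L2nn_multiplier[OF \<Omega> h[unfolded M_def] m B g(2), folded M_def]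
    have KK: "ennreal (B\<^sup>2) \<le> ennreal K" "ennreal (1 / m\<^sup>2) \<le> ennreal K"
      unfolding K_def by (auto intro!: ennreal_leI)
    then show "L2nn lborel f \<le> ennreal K * L2nn M h" "L2nn M h \<le> ennreal K * L2nn lborel f"
      using order_trans[OF mult(1) mult_right_mono[OF KK(1)]]
        order_trans[OF mult(2) mult_right_mono[OF KK(2)]] has_L2_fourier_L2nn[OF g(1)] by simp_all
  qed
  \<comment> \<open>Approximation errors with equal coefficients correspond under \<open>T\<close>,
    so \<open>T_norms\<close> compares them.\<close>
  have T_sum: "T (\<lambda>x. (\<Sum>a\<in>F. c a * \<phi> (x - a)) - f x) (\<lambda>\<xi>. (\<Sum>a\<in>F. c a * cis (- 2 * pi * (\<xi> \<bullet> a))) - h \<xi>)"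
    if T: "T f h" and F: "finite F" for f h c F
    unfolding T_def
  proof (intro conjI)
    obtain g where h [measurable]: "h \<in> borel_measurable M" and g: "has_L2_fourier f g"
      "AE \<xi> in lborel. g \<xi> = (if \<xi> \<in> \<Omega> then \<phi>hat \<xi> * h \<xi> else 0)"
      using T by (auto simp: T_def)
    have [measurable]: "(\<lambda>\<xi>. \<Sum>a\<in>F. c a * cis (- 2 * pi * (\<xi> \<bullet> a))) \<in> borel_measurable M"
      unfolding M_def by (intro measurable_restrict_space1) measurable
    show "(\<lambda>\<xi>. (\<Sum>a\<in>F. c a * cis (- 2 * pi * (\<xi> \<bullet> a))) - h \<xi>) \<in> borel_measurable M"
      by measurable
    have "has_L2_fourier (\<lambda>x. (\<Sum>a\<in>F. c a * \<phi> (x - a)) - f x)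
        (\<lambda>\<xi>. (\<Sum>a\<in>F. c a * (cis (- 2 * pi * (\<xi> \<bullet> a)) * \<phi>hat \<xi>)) - g \<xi>)"
      by (intro has_L2_fourier_diff has_L2_fourier_sum F has_L2_fourier_translate hat g)
    \<comment> \<open>Off \<Omega> the exponential sum disappears because \<open>\<phi>hat\<close>
      vanishes there almost everywhere.\<close>
    moreover have "AE \<xi> in lborel. (\<Sum>a\<in>F. c a * (cis (- 2 * pi * (\<xi> \<bullet> a)) * \<phi>hat \<xi>)) - g \<xi>
        = (if \<xi> \<in> \<Omega> then \<phi>hat \<xi> * ((\<Sum>a\<in>F. c a * cis (- 2 * pi * (\<xi> \<bullet> a))) - h \<xi>) else 0)"
      using g(2) hat0
      by eventually_elim (auto simp: algebra_simps sum_distrib_left)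
    ultimately show "\<exists>g. has_L2_fourier (\<lambda>x. (\<Sum>a\<in>F. c a * \<phi> (x - a)) - f x) g \<and>
      (AE \<xi> in lborel. g \<xi> = (if \<xi> \<in> \<Omega> then \<phi>hat \<xi> * ((\<Sum>a\<in>F. c a * cis (- 2 * pi * (\<xi> \<bullet> a))) - h \<xi>) else 0))"
      by blast
  qed
  have to_L2: "\<exists>h\<in>L2 M. T f h" if "f \<in> PW \<Omega>" for f
  proof -
    obtain g where g: "has_L2_fourier f g" "AE \<xi> in lborel. \<xi> \<notin> \<Omega> \<longrightarrow> g \<xi> = 0"
      using \<open>f \<in> PW \<Omega>\<close> by (auto simp: PW_def)
    have g2: "g \<in> L2 lborel" and f2: "f \<in> L2 lborel" using g by (auto simp: has_L2_fourier_iff)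
    note [measurable] = L2D(1)[OF g2]
    have "(\<lambda>\<xi>. g \<xi> / \<phi>hat \<xi>) \<in> borel_measurable M"
      unfolding M_def by (intro measurable_restrict_space1) measurable
    moreover have "AE \<xi> in lborel. g \<xi> = (if \<xi> \<in> \<Omega> then \<phi>hat \<xi> * (g \<xi> / \<phi>hat \<xi>) else 0)"
      using g(2) by eventually_elim (use assms(8) in auto)
    ultimately have T: "T f (\<lambda>\<xi>. g \<xi> / \<phi>hat \<xi>)"
      using g(1) by (auto simp: T_def)
    have "L2nn M (\<lambda>\<xi>. g \<xi> / \<phi>hat \<xi>) < \<infinity>"
      using L2D(3)[OF f2] by (intro le_less_trans[OF T_norms(2)[OF T]]) (auto simp: ennreal_mult_less_top)
    moreover have "(\<lambda>\<xi>. g \<xi> / \<phi>hat \<xi>) \<in> borel_measurable M" using T by (simp add: T_def)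
    ultimately show ?thesis using T L2I by blast
  qed
  have to_PW: "\<exists>f\<in>PW \<Omega>. T f h" if "h \<in> L2 M" for h
  proof -
    define G where "G \<xi> = \<phi>hat \<xi> * trunc \<Omega> h \<xi>" for \<xi>
    have h: "h \<in> borel_measurable M" using L2D(1)[OF that] .
    have th: "trunc \<Omega> h \<in> L2 lborel"
      using that \<Omega> by (simp add: M_def L2_restrict_space_iff)
    have Geq: "G \<xi> = (if \<xi> \<in> \<Omega> then \<phi>hat \<xi> * h \<xi> else 0)" for \<xi>
      by (simp add: G_def trunc_apply)
    have "L2nn lborel G \<le> ennreal (B\<^sup>2) * L2nn M h"
      unfolding M_def using h[unfolded M_def] m B by (intro L2nn_multiplier \<Omega>) (auto simp: Geq)
    also have "\<dots> < \<infinity>" using L2D(3)[OF that] by (simp add: ennreal_mult_less_top)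
    finally have G2: "G \<in> L2 lborel"
      using L2D(1)[OF th] unfolding G_def by (intro L2I) auto
    \<comment> \<open>Boundedness of \<Omega>, through the radius \<open>r\<close>, is what admits
      the explicit inverse transform.\<close>
    have fG: "has_L2_fourier (\<lambda>x. cnj (ft (\<lambda>\<xi>. cnj (G \<xi>)) x)) G"
      by (rule has_L2_fourier_inverse[OF G2, of r]) (use r in \<open>auto simp: Geq\<close>)
    then have "T (\<lambda>x. cnj (ft (\<lambda>\<xi>. cnj (G \<xi>)) x)) h"
      using h Geq by (auto simp: T_def)
    moreover have "(\<lambda>x. cnj (ft (\<lambda>\<xi>. cnj (G \<xi>)) x)) \<in> PW \<Omega>"
      using fG unfolding PW_def has_L2_fourier_iff by (auto simp: Geq)
    ultimately show ?thesis by blast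
  qed
  have PW_L2: "f \<in> L2 lborel" if "f \<in> PW \<Omega>" for f
    using that by (auto simp: PW_def)
  show ?thesis
    unfolding M_def[symmetric]
  proof
    assume "riesz_basis lborel (PW \<Omega>) A (\<lambda>a x. \<phi> (x - a))"
    then show "riesz_basis M (L2 M) A (\<lambda>a x. cis (- 2 * pi * (x \<bullet> a)))"
    proof (rule riesz_basis_transfer[OF K, rotated])
      fix h assume h: "h \<in> L2 M"
      then obtain f where f: "f \<in> PW \<Omega>" "T f h" using to_PW by blast
      show "\<exists>f\<in>PW \<Omega>. h \<in> L2 M \<and> f \<in> L2 lborel \<and>
        L2nn M h \<le> ennreal K * L2nn lborel f \<and> L2nn lborel f \<le> ennreal K * L2nn M h \<and>
        (\<forall>c F. finite F \<longrightarrow> L2nn M (\<lambda>x. (\<Sum>a\<in>F. c a * cis (- 2 * pi * (x \<bullet> a))) - h x)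
            \<le> ennreal K * L2nn lborel (\<lambda>x. (\<Sum>a\<in>F. c a * \<phi> (x - a)) - f x))"
        using h f(2) by (intro bexI[OF _ f(1)] conjI allI impI T_norms T_sum PW_L2 f)
    qed
  next
    assume "riesz_basis M (L2 M) A (\<lambda>a x. cis (- 2 * pi * (x \<bullet> a)))"
    then show "riesz_basis lborel (PW \<Omega>) A (\<lambda>a x. \<phi> (x - a))"
    proof (rule riesz_basis_transfer[OF K, rotated])
      fix f assume f: "f \<in> PW \<Omega>"
      then obtain h where h: "h \<in> L2 M" "T f h" using to_L2 by blast
      show "\<exists>h\<in>L2 M. f \<in> L2 lborel \<and> h \<in> L2 M \<and>
        L2nn lborel f \<le> ennreal K * L2nn M h \<and> L2nn M h \<le> ennreal K * L2nn lborel f \<and>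
        (\<forall>c F. finite F \<longrightarrow> L2nn lborel (\<lambda>x. (\<Sum>a\<in>F. c a * \<phi> (x - a)) - f x)
            \<le> ennreal K * L2nn M (\<lambda>x. (\<Sum>a\<in>F. c a * cis (- 2 * pi * (x \<bullet> a))) - h x))"
        using f h(2) by (intro bexI[OF _ h(1)] conjI allI impI T_norms T_sum PW_L2 h)
    qed
  qed
qed

end
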